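(* Let $G=(V,E)$ be an infinite, connected graph of bounded degree. If $p_0\in(0,1)$ is such that \[ \lim_{n\to\infty}\max\bigl\{\mathbb P_{p_0}(A\nleftrightarrow B):A,B\subseteq V,\ |A|,|B|\ge n\bigr\}=0, \] then Bernoulli-$p$ bond percolation on $G$ has a unique infinite cluster almost surely for every $p>p_0$.
   Context: $\mathbb P_p$ is the law of Bernoulli-$p$ bond percolation on $G$ (each edge open independently with probability $p$). $\{A\leftrightarrow B\}$ is the event that some open path connects a vertex of $A$ to a vertex of $B$, and $\{A\nleftrightarrow B\}$ is its complement. (The sets $A,B$ in the maximum may be taken finite.) *)

theory Defs
  imports "HOL-Probability.Probability"
begin

definition graph_edges :: "('v \<Rightarrow> 'v \<Rightarrow> bool) \<Rightarrow> 'v set set" where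
  "graph_edges adj = {{u, v} | u v. adj u v}"

definition simple_graph :: "('v \<Rightarrow> 'v \<Rightarrow> bool) \<Rightarrow> bool" where
  "simple_graph adj \<longleftrightarrow> (\<forall>u v. adj u v \<longrightarrow> adj v u) \<and> (\<forall>v. \<not> adj v v)"

definition graph_connected :: "('v \<Rightarrow> 'v \<Rightarrow> bool) \<Rightarrow> bool" where
  "graph_connected adj \<longleftrightarrow> (\<forall>u v. adj\<^sup>*\<^sup>* u v)"

definition bounded_degree :: "('v \<Rightarrow> 'v \<Rightarrow> bool) \<Rightarrow> bool" where
  "bounded_degree adj \<longleftrightarrow> (\<exists>d::nat. \<forall>v. finite {u. adj v u} \<and> card {u. adj v u} \<le> d)"

text \<open>Law of Bernoulli-p bond percolation: product of Bernoulli(p) over the edges.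
A configuration assigns to each edge True (open) or False (closed).\<close>

definition perc :: "('v \<Rightarrow> 'v \<Rightarrow> bool) \<Rightarrow> real \<Rightarrow> ('v set \<Rightarrow> bool) measure" where
  "perc adj p = PiM (graph_edges adj) (\<lambda>_. measure_pmf (bernoulli_pmf p))"

definition open_conn :: "('v \<Rightarrow> 'v \<Rightarrow> bool) \<Rightarrow> ('v set \<Rightarrow> bool) \<Rightarrow> 'v \<Rightarrow> 'v \<Rightarrow> bool" where
  "open_conn adj \<omega> = (\<lambda>u v. adj u v \<and> \<omega> {u, v})\<^sup>*\<^sup>*"

definition cluster :: "('v \<Rightarrow> 'v \<Rightarrow> bool) \<Rightarrow> ('v set \<Rightarrow> bool) \<Rightarrow> 'v \<Rightarrow> 'v set" where
  "cluster adj \<omega> x = {y. open_conn adj \<omega> x y}"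

definition connects :: "('v \<Rightarrow> 'v \<Rightarrow> bool) \<Rightarrow> 'v set \<Rightarrow> 'v set \<Rightarrow> ('v set \<Rightarrow> bool) set" where
  "connects adj A B = {\<omega>. \<exists>a\<in>A. \<exists>b\<in>B. open_conn adj \<omega> a b}"

definition max_disconn :: "('v \<Rightarrow> 'v \<Rightarrow> bool) \<Rightarrow> real \<Rightarrow> nat \<Rightarrow> real" where
  "max_disconn adj p n =
     (SUP AB \<in> {(A, B). finite A \<and> finite B \<and> card A \<ge> n \<and> card B \<ge> n}.
        measure (perc adj p) (space (perc adj p) - connects adj (fst AB) (snd AB)))"

definition unique_infinite_cluster :: "('v \<Rightarrow> 'v \<Rightarrow> bool) \<Rightarrow> ('v set \<Rightarrow> bool) \<Rightarrow> bool" where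
  "unique_infinite_cluster adj \<omega> \<longleftrightarrow>
     (\<exists>x. infinite (cluster adj \<omega> x) \<and>
        (\<forall>y. infinite (cluster adj \<omega> y) \<longrightarrow> cluster adj \<omega> y = cluster adj \<omega> x))"

end

theory Submission
  imports Defs
begin

text \<open>
  Build Bernoulli-\<open>p\<close> percolation in three independent layers: layer 0 is Bernoulli-\<open>p\<^sub>0\<close>, and
  layers 1 and 2 sprinkle additional edges. Layer 0 alone has an infinite cluster almost surely, since
  a large finite set is very likely to be connected to any large set far away. It therefore
  suffices that an infinite cluster of \<open>x\<close> in all three layers and an infinite cluster of \<open>y\<close>
  in layer 0 almost surely belong to the same three-layer cluster.

  Inside a finite window explore the three-layer cluster of \<open>x\<close>, giving \<open>A\<close>, and the layer-0
  cluster of \<open>y\<close>, giving \<open>B\<close>. For percolation with unexplored randomness, \<open>A\<close> and \<open>B\<close> are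
  connected with high probability: closing or opening few edges costs only a constant factor, so
  many boundary edges of \<open>B\<close> must lead to \<open>A\<close>, and layer 1 opens one of them. The same
  argument at \<open>A\<close> shows that many boundary edges of \<open>A\<close> lead to the cluster \<open>D\<close> of \<open>y\<close> in layers
  0 and 1. The set of edges joining \<open>D\<close> to the cluster of \<open>x\<close> off \<open>D\<close> is independent of
  layer 2 on these edges, and if \<open>x\<close> and \<open>y\<close> are not connected then layer 2 is closed on all
  of them, which is unlikely when there are many.
\<close>

subsection \<open>Independent Bernoulli variables\<close>

text \<open>The rate may vary with the coordinate because the layers of the coupling below are
  opened at different rates.\<close>

definition bern :: "'i set \<Rightarrow> ('i \<Rightarrow> real) \<Rightarrow> ('i \<Rightarrow> bool) measure" where
  "bern I q = PiM I (\<lambda>i. measure_pmf (bernoulli_pmf (q i)))"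

lemma perc_eq_bern: "perc adj p = bern (graph_edges adj) (\<lambda>_. p)"
  by (simp add: perc_def bern_def)

lemma prob_space_bern: "prob_space (bern I q)"
  unfolding bern_def by (intro prob_space_PiM prob_space_measure_pmf)

lemma sets_bern: "sets (bern I q) = sets (PiM I (\<lambda>_. count_space UNIV))"
  unfolding bern_def by (intro sets_PiM_cong) simp_all

lemma space_bern: "space (bern I q) = PiE I (\<lambda>_. UNIV)"
  by (simp add: bern_def space_PiM)

lemma bern_coord_measurable [measurable]:
  "i \<in> I \<Longrightarrow> Measurable.pred (bern I q) (\<lambda>\<omega>. \<omega> i)"
  by (subst measurable_cong_sets[OF sets_bern refl]) (rule measurable_component_singleton)

lemma measurable_bernI:
  assumes "\<And>i. i \<in> I \<Longrightarrow> Measurable.pred M (\<lambda>x. f x i)"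
  shows "(\<lambda>x. \<lambda>i\<in>I. f x i) \<in> M \<rightarrow>\<^sub>M bern I q"
  by (subst measurable_cong_sets[OF refl sets_bern]) (intro measurable_restrict assms)

text \<open>Independence amounts to the joint law being the product of the marginal laws. Here the
  joint map is the identity on the space, so its law is the product measure itself.\<close>

lemma indep_vars_bern_coord:
  assumes "I \<noteq> {}"
  shows "prob_space.indep_vars (bern I q) (\<lambda>i. measure_pmf (bernoulli_pmf (q i))) (\<lambda>i \<omega>. \<omega> i) I"
proof -
  interpret prob_space "bern I q" by (rule prob_space_bern)
  let ?M = "\<lambda>i. measure_pmf (bernoulli_pmf (q i))"
  have coord: "(\<lambda>\<omega>. \<omega> i) \<in> bern I q \<rightarrow>\<^sub>M ?M i" if "i \<in> I" for i
    unfolding bern_def using that by (rule measurable_component_singleton)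
  have "distr (bern I q) (PiM I ?M) (\<lambda>x. \<lambda>i\<in>I. x i) = distr (bern I q) (bern I q) (\<lambda>x. x)"
    unfolding bern_def by (intro distr_cong) (auto simp: space_PiM)
  also have "\<dots> = PiM I ?M"
    by (simp add: bern_def)
  also have "\<dots> = PiM I (\<lambda>i. distr (bern I q) (?M i) (\<lambda>\<omega>. \<omega> i))"
    unfolding bern_def
    by (intro PiM_cong refl distr_PiM_component[symmetric] prob_space_measure_pmf)
  finally show ?thesis
    using assms by (subst indep_vars_iff_distr_eq_PiM') (simp_all add: coord)
qed

text \<open>A pointwise condition on functions, free of sigma-algebras, so that locality of
  percolation events can be checked combinatorially.\<close>

definition depends_on :: "'i set \<Rightarrow> (('i \<Rightarrow> bool) \<Rightarrow> 'a) \<Rightarrow> bool" where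
  "depends_on J f \<longleftrightarrow> (\<forall>\<omega> \<omega>'. (\<forall>i\<in>J. \<omega> i = \<omega>' i) \<longrightarrow> f \<omega> = f \<omega>')"

lemma depends_onI:
  "(\<And>\<omega> \<omega>'. (\<And>i. i \<in> J \<Longrightarrow> \<omega> i = \<omega>' i) \<Longrightarrow> f \<omega> = f \<omega>') \<Longrightarrow> depends_on J f"
  unfolding depends_on_def by blast

lemma depends_onD:
  "depends_on J f \<Longrightarrow> (\<And>i. i \<in> J \<Longrightarrow> \<omega> i = \<omega>' i) \<Longrightarrow> f \<omega> = f \<omega>'"
  unfolding depends_on_def by blast

text \<open>The restrictions of the configuration to the disjoint sets \<open>J\<close> and
  \<open>K\<close> are independent, and each event factors through its own restriction.\<close>

lemma bern_indep:
  assumes P: "Measurable.pred (bern I q) P" and Q: "Measurable.pred (bern I q) Q"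
    and dP: "depends_on J P" and dQ: "depends_on K Q"
    and J: "J \<subseteq> I" and K: "K \<subseteq> I" and JK: "J \<inter> K = {}"
  shows "measure (bern I q) {\<omega>\<in>space (bern I q). P \<omega> \<and> Q \<omega>} =
    measure (bern I q) {\<omega>\<in>space (bern I q). P \<omega>} * measure (bern I q) {\<omega>\<in>space (bern I q). Q \<omega>}"
\<comment> \<open>The independence of the coordinates was obtained for nonempty \<open>I\<close>.
  For empty \<open>I\<close> the space is a single point and every event has probability 0 or
  1.\<close>
proof (cases "I = {}")
  case True
  interpret prob_space "bern I q" by (rule prob_space_bern)
  have sp: "space (bern I q) = {\<lambda>_. undefined}"
    using True by (simp add: space_bern)
  have "{\<omega>\<in>space (bern I q). R \<omega>} = (if R (\<lambda>_. undefined) then space (bern I q) else {})" for R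
    by (auto simp: sp)
  note * = this
  show ?thesis
    unfolding *[of P] *[of Q] *[of "\<lambda>\<omega>. P \<omega> \<and> Q \<omega>"] using prob_space by auto
next
  case False
  interpret prob_space "bern I q" by (rule prob_space_bern)
  let ?M = "\<lambda>i. measure_pmf (bernoulli_pmf (q i))"
  \<comment> \<open>\<open>ext L\<close> turns a configuration on \<open>L\<close> into one on
    \<open>I\<close> by filling the other coordinates with \<open>False\<close>. An event depending
    only on \<open>L\<close> does not notice the filling, which gives its factorisation through the
    restriction.\<close>
  define ext where "ext L \<omega> = (\<lambda>i\<in>I. i \<in> L \<and> \<omega> i)" for L and \<omega> :: "'a \<Rightarrow> bool"
  have ext: "ext L \<in> PiM L ?M \<rightarrow>\<^sub>M bern I q" if "L \<subseteq> I" for L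
    unfolding ext_def
  proof (intro measurable_bernI)
    fix i assume "i \<in> I"
    show "Measurable.pred (PiM L ?M) (\<lambda>\<omega>. i \<in> L \<and> \<omega> i)"
    proof (cases "i \<in> L")
      case True
      then have "Measurable.pred (PiM L ?M) (\<lambda>\<omega>. \<omega> i)"
        unfolding bern_def[symmetric] by (rule bern_coord_measurable)
      then show ?thesis by (simp only: True simp_thms)
    qed simp
  qed
  define A where "A = {\<omega>\<in>space (PiM J ?M). P (ext J \<omega>)}"
  define B where "B = {\<omega>\<in>space (PiM K ?M). Q (ext K \<omega>)}"
  have A: "A \<in> sets (PiM J ?M)"
    unfolding A_def by (rule predE[OF measurable_compose[OF ext[OF J] P]])
  have B: "B \<in> sets (PiM K ?M)"
    unfolding B_def by (rule predE[OF measurable_compose[OF ext[OF K] Q]])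
  have "indep_var (PiM J ?M) (\<lambda>\<omega>. restrict (\<lambda>i. \<omega> i) J) (PiM K ?M) (\<lambda>\<omega>. restrict (\<lambda>i. \<omega> i) K)"
    by (rule indep_var_restrict[OF indep_vars_bern_coord[OF False] JK J K])
  then have "prob ((\<lambda>\<omega>. (restrict \<omega> J, restrict \<omega> K)) -` (A \<times> B) \<inter> space (bern I q)) =
    prob ((\<lambda>\<omega>. restrict \<omega> J) -` A \<inter> space (bern I q)) * prob ((\<lambda>\<omega>. restrict \<omega> K) -` B \<inter> space (bern I q))"
    using A B by (rule indep_varD)
  moreover have PA: "P (ext J (restrict \<omega> J)) = P \<omega>" for \<omega>
    using J by (intro depends_onD[OF dP]) (auto simp: ext_def)
  moreover have QB: "Q (ext K (restrict \<omega> K)) = Q \<omega>" for \<omega>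
    using K by (intro depends_onD[OF dQ]) (auto simp: ext_def)
  moreover have "(\<lambda>\<omega>. restrict \<omega> J) -` A \<inter> space (bern I q) = {\<omega>\<in>space (bern I q). P \<omega>}"
    by (auto simp: A_def PA space_PiM)
  moreover have "(\<lambda>\<omega>. restrict \<omega> K) -` B \<inter> space (bern I q) = {\<omega>\<in>space (bern I q). Q \<omega>}"
    by (auto simp: B_def QB space_PiM)
  moreover have "(\<lambda>\<omega>. (restrict \<omega> J, restrict \<omega> K)) -` (A \<times> B) \<inter> space (bern I q) =
      {\<omega>\<in>space (bern I q). P \<omega> \<and> Q \<omega>}"
    by (auto simp: A_def B_def PA QB space_PiM)
  ultimately show ?thesis
    by simp
qed

lemma bern_all_closed:
  assumes "finite S" "S \<subseteq> I" "\<And>i. i \<in> S \<Longrightarrow> 0 \<le> q i \<and> q i \<le> 1"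
  shows "measure (bern I q) {\<omega>\<in>space (bern I q). \<forall>i\<in>S. \<not> \<omega> i} = (\<Prod>i\<in>S. 1 - q i)"
proof -
  let ?M = "\<lambda>i. measure_pmf (bernoulli_pmf (q i))"
  interpret product_prob_space ?M I ..
  have "{\<omega>\<in>space (bern I q). \<forall>i\<in>S. \<not> \<omega> i} = prod_emb I ?M S (PiE S (\<lambda>_. {False}))"
    using assms(2) by (auto simp: prod_emb_def space_bern restrict_def fun_eq_iff)
  then have "measure (bern I q) {\<omega>\<in>space (bern I q). \<forall>i\<in>S. \<not> \<omega> i} = (\<Prod>i\<in>S. measure (?M i) {False})"
    unfolding bern_def using assms by (subst measure_PiM_emb[symmetric]) simp_all
  also have "\<dots> = (\<Prod>i\<in>S. 1 - q i)"
    using assms by (intro prod.cong) (auto simp: measure_pmf_single)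
  finally show ?thesis .
qed

text \<open>A stopping-set property: the event that the random set equals \<^term>\<open>S\<close> gives no information
about the coordinates in \<^term>\<open>S\<close>.\<close>

lemma bern_random_set:
  fixes T :: "('i \<Rightarrow> bool) \<Rightarrow> 'i set"
  assumes q: "\<And>i. i \<in> I \<Longrightarrow> 0 \<le> q i \<and> q i \<le> 1"
    and F: "finite F" "F \<subseteq> I" and TF: "\<And>\<omega>. T \<omega> \<subseteq> F"
    and meas: "\<And>i. i \<in> F \<Longrightarrow> Measurable.pred (bern I q) (\<lambda>\<omega>. i \<in> T \<omega>)"
    and local: "\<And>S. S \<subseteq> F \<Longrightarrow> depends_on (I - S) (\<lambda>\<omega>. T \<omega> = S)"
  shows "measure (bern I q) {\<omega>\<in>space (bern I q). R (T \<omega>) \<and> (\<forall>i\<in>T \<omega>. \<not> \<omega> i)} =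
     (\<Sum>S | S \<subseteq> F \<and> R S. measure (bern I q) {\<omega>\<in>space (bern I q). T \<omega> = S} * (\<Prod>i\<in>S. 1 - q i))" (is ?closed)
   and "measure (bern I q) {\<omega>\<in>space (bern I q). R (T \<omega>)} =
     (\<Sum>S | S \<subseteq> F \<and> R S. measure (bern I q) {\<omega>\<in>space (bern I q). T \<omega> = S})" (is ?all)
   and "Measurable.pred (bern I q) (\<lambda>\<omega>. T \<omega> = S)"
proof -
  interpret prob_space "bern I q" by (rule prob_space_bern)
  have TS: "Measurable.pred (bern I q) (\<lambda>\<omega>. T \<omega> = S)" for S
  proof (cases "S \<subseteq> F")
    case True
    have "(\<lambda>\<omega>. T \<omega> = S) = (\<lambda>\<omega>. \<forall>i\<in>F. i \<in> T \<omega> \<longleftrightarrow> i \<in> S)"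
      using True TF by (intro ext) blast
    then show ?thesis
      using F(1) meas by (simp add: pred_intros_finite)
  next
    case False
    then have "(\<lambda>\<omega>. T \<omega> = S) = (\<lambda>_. False)" using TF by (intro ext) blast
    then show ?thesis by simp
  qed
  then show "Measurable.pred (bern I q) (\<lambda>\<omega>. T \<omega> = S)" .
  have fin: "finite {S. S \<subseteq> F \<and> R S}"
    using F(1) by simp
  have clS: "Measurable.pred (bern I q) (\<lambda>\<omega>. \<forall>i\<in>S. \<not> \<omega> i)" if "S \<subseteq> F" for S
    using that F by (intro pred_intros_finite pred_intros_logic bern_coord_measurable)
       (auto intro: finite_subset)
  have TSs: "{\<omega>\<in>space (bern I q). T \<omega> = S} \<in> sets (bern I q)" for S
    by (rule predE[OF TS])
  have TSc: "{\<omega>\<in>space (bern I q). T \<omega> = S \<and> (\<forall>i\<in>S. \<not> \<omega> i)} \<in> sets (bern I q)" if "S \<subseteq> F" for S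
    by (rule predE[OF pred_intros_logic(3)[OF TS clS[OF that]]])
  have "{\<omega>\<in>space (bern I q). R (T \<omega>) \<and> (\<forall>i\<in>T \<omega>. \<not> \<omega> i)} =
    (\<Union>S\<in>{S. S \<subseteq> F \<and> R S}. {\<omega>\<in>space (bern I q). T \<omega> = S \<and> (\<forall>i\<in>S. \<not> \<omega> i)})"
    using TF by auto
  also have "prob \<dots> = (\<Sum>S\<in>{S. S \<subseteq> F \<and> R S}. prob {\<omega>\<in>space (bern I q). T \<omega> = S \<and> (\<forall>i\<in>S. \<not> \<omega> i)})"
    by (intro finite_measure_finite_Union fin image_subsetI TSc) (auto simp: disjoint_family_on_def)
  also have "\<dots> = (\<Sum>S\<in>{S. S \<subseteq> F \<and> R S}. prob {\<omega>\<in>space (bern I q). T \<omega> = S} * (\<Prod>i\<in>S. 1 - q i))"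
  proof (intro sum.cong refl)
    fix S assume S: "S \<in> {S. S \<subseteq> F \<and> R S}"
    then have SF: "S \<subseteq> F" and SI: "S \<subseteq> I" and fS: "finite S" using F by (auto intro: finite_subset)
    \<comment> \<open>The stopping property enters here: \<open>T \<omega> = S\<close> is decided by
      coordinates outside \<open>S\<close>, and closedness of \<open>S\<close> by those
      inside.\<close>
    have "prob {\<omega>\<in>space (bern I q). T \<omega> = S \<and> (\<forall>i\<in>S. \<not> \<omega> i)} =
      prob {\<omega>\<in>space (bern I q). T \<omega> = S} * prob {\<omega>\<in>space (bern I q). \<forall>i\<in>S. \<not> \<omega> i}"
      by (rule bern_indep[OF TS clS[OF SF] local[OF SF], of S])
         (use SI in \<open>auto intro!: depends_onI\<close>)
    also have "prob {\<omega>\<in>space (bern I q). \<forall>i\<in>S. \<not> \<omega> i} = (\<Prod>i\<in>S. 1 - q i)"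
      using SI fS q by (intro bern_all_closed) auto
    finally show "prob {\<omega>\<in>space (bern I q). T \<omega> = S \<and> (\<forall>i\<in>S. \<not> \<omega> i)} =
       prob {\<omega>\<in>space (bern I q). T \<omega> = S} * (\<Prod>i\<in>S. 1 - q i)" .
  qed
  finally show ?closed .
  have "{\<omega>\<in>space (bern I q). R (T \<omega>)} =
    (\<Union>S\<in>{S. S \<subseteq> F \<and> R S}. {\<omega>\<in>space (bern I q). T \<omega> = S})"
    using TF by auto
  also have "prob \<dots> = (\<Sum>S\<in>{S. S \<subseteq> F \<and> R S}. prob {\<omega>\<in>space (bern I q). T \<omega> = S})"
    by (intro finite_measure_finite_Union fin image_subsetI TSs) (auto simp: disjoint_family_on_def)
  finally show ?all .
qed

text \<open>Given \<open>T \<omega> = S\<close>, the coordinates in \<open>S\<close> keep their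
  product law, so a set of at least \<open>k\<close> of them is entirely closed with conditional
  probability at most \<open>(1 - s) ^ k\<close>. Averaging over \<open>S\<close> keeps the
  bound.\<close>

lemma bern_large_random_set_closed_le:
  fixes T :: "('i \<Rightarrow> bool) \<Rightarrow> 'i set"
  assumes q: "\<And>i. i \<in> I \<Longrightarrow> 0 \<le> q i \<and> q i \<le> 1"
    and F: "finite F" "F \<subseteq> I" and TF: "\<And>\<omega>. T \<omega> \<subseteq> F"
    and meas: "\<And>i. i \<in> F \<Longrightarrow> Measurable.pred (bern I q) (\<lambda>\<omega>. i \<in> T \<omega>)"
    and local: "\<And>S. S \<subseteq> F \<Longrightarrow> depends_on (I - S) (\<lambda>\<omega>. T \<omega> = S)"
    and s: "\<And>i. i \<in> F \<Longrightarrow> s \<le> q i" "0 \<le> s" "s \<le> 1"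
  shows "measure (bern I q) {\<omega>\<in>space (bern I q). k \<le> card (T \<omega>) \<and> (\<forall>i\<in>T \<omega>. \<not> \<omega> i)} \<le> (1 - s) ^ k"
proof -
  interpret prob_space "bern I q" by (rule prob_space_bern)
  have "(\<Prod>i\<in>S. 1 - q i) \<le> (1 - s) ^ k" if "S \<subseteq> F" "k \<le> card S" for S
  proof -
    have "(\<Prod>i\<in>S. 1 - q i) \<le> (\<Prod>i\<in>S. 1 - s)"
      using that s q F by (intro prod_mono) force
    also have "\<dots> \<le> (1 - s) ^ k"
      using that s by (simp add: power_decreasing)
    finally show ?thesis .
  qed
  then have "prob {\<omega>\<in>space (bern I q). k \<le> card (T \<omega>) \<and> (\<forall>i\<in>T \<omega>. \<not> \<omega> i)} \<le>
     (\<Sum>S | S \<subseteq> F \<and> k \<le> card S. prob {\<omega>\<in>space (bern I q). T \<omega> = S} * (1 - s) ^ k)"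
    by (subst bern_random_set(1)[OF q F TF meas local]) (auto intro!: sum_mono mult_left_mono)
  also have "\<dots> = prob {\<omega>\<in>space (bern I q). k \<le> card (T \<omega>)} * (1 - s) ^ k"
    by (subst bern_random_set(2)[OF q F TF meas local]) (auto simp: sum_distrib_right)
  also have "\<dots> \<le> 1 * (1 - s) ^ k"
    using s by (intro mult_right_mono) auto
  finally show ?thesis by simp
qed

text \<open>The opposite use of the same decomposition: fewer than \<open>k\<close> coordinates are
  all closed with conditional probability at least \<open>c ^ k\<close>. Hence, if it is unlikely
  that the random set is entirely closed, it is also unlikely that it is small.\<close>

lemma bern_small_random_set_closed_ge:
  fixes T :: "('i \<Rightarrow> bool) \<Rightarrow> 'i set"
  assumes q: "\<And>i. i \<in> I \<Longrightarrow> 0 \<le> q i \<and> q i \<le> 1"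
    and F: "finite F" "F \<subseteq> I" and TF: "\<And>\<omega>. T \<omega> \<subseteq> F"
    and meas: "\<And>i. i \<in> F \<Longrightarrow> Measurable.pred (bern I q) (\<lambda>\<omega>. i \<in> T \<omega>)"
    and local: "\<And>S. S \<subseteq> F \<Longrightarrow> depends_on (I - S) (\<lambda>\<omega>. T \<omega> = S)"
    and c: "\<And>i. i \<in> F \<Longrightarrow> c \<le> 1 - q i" "0 \<le> c" "c \<le> 1"
  shows "c ^ k * measure (bern I q) {\<omega>\<in>space (bern I q). card (T \<omega>) < k}
     \<le> measure (bern I q) {\<omega>\<in>space (bern I q). \<forall>i\<in>T \<omega>. \<not> \<omega> i}"
proof -
  interpret prob_space "bern I q" by (rule prob_space_bern)
  have *: "c ^ k \<le> (\<Prod>i\<in>S. 1 - q i)" if "S \<subseteq> F" "card S < k" for S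
  proof -
    have "c ^ k \<le> c ^ card S"
      using that c by (intro power_decreasing) auto
    also have "\<dots> = (\<Prod>i\<in>S. c)" by simp
    also have "\<dots> \<le> (\<Prod>i\<in>S. 1 - q i)"
      using that c by (intro prod_mono) auto
    finally show ?thesis .
  qed
  have "c ^ k * prob {\<omega>\<in>space (bern I q). card (T \<omega>) < k} =
     (\<Sum>S | S \<subseteq> F \<and> card S < k. c ^ k * prob {\<omega>\<in>space (bern I q). T \<omega> = S})"
    by (subst bern_random_set(2)[OF q F TF meas local]) (auto simp: sum_distrib_left)
  also have "\<dots> \<le> (\<Sum>S | S \<subseteq> F \<and> card S < k. prob {\<omega>\<in>space (bern I q). T \<omega> = S} * (\<Prod>i\<in>S. 1 - q i))"
    by (subst mult.commute) (intro sum_mono mult_left_mono, auto intro: *)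
  also have "\<dots> \<le> (\<Sum>S | S \<subseteq> F \<and> True. prob {\<omega>\<in>space (bern I q). T \<omega> = S} * (\<Prod>i\<in>S. 1 - q i))"
    using F q by (intro sum_mono2) (auto intro!: mult_nonneg_nonneg prod_nonneg)
  also have "\<dots> = prob {\<omega>\<in>space (bern I q). True \<and> (\<forall>i\<in>T \<omega>. \<not> \<omega> i)}"
    by (subst bern_random_set(1)[OF q F TF meas local]) auto
  finally show ?thesis by simp
qed

lemma (in finite_measure) measure_incseq_Union_le:
  assumes "\<And>m::nat. E m \<in> sets M" "incseq E" "\<And>m. measure M (E m) \<le> b"
  shows "measure M (\<Union>m. E m) \<le> b"
proof (rule LIMSEQ_le_const2)
  show "(\<lambda>m. measure M (E m)) \<longlonglongrightarrow> measure M (\<Union>m. E m)"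
    using assms(1,2) by (intro finite_Lim_measure_incseq) auto
  show "\<exists>N. \<forall>m\<ge>N. measure M (E m) \<le> b"
    using assms(3) by blast
qed

subsection \<open>Open connections\<close>

lemma pred_constant: "Measurable.pred M (\<lambda>_. c)"
  by simp

text \<open>Countability of the vertices is a derived fact and not a type class property, so
  quantifiers over vertices are turned into quantifiers over \<open>nat\<close> by an
  enumeration.\<close>

lemma pred_ex_countable:
  assumes "countable (UNIV :: 'v set)" "\<And>v::'v. Measurable.pred M (\<lambda>\<omega>. P \<omega> v)"
  shows "Measurable.pred M (\<lambda>\<omega>. \<exists>v. P \<omega> v)"
proof -
  have "(\<lambda>\<omega>. \<exists>v. P \<omega> v) = (\<lambda>\<omega>. \<exists>n::nat. P \<omega> (from_nat_into UNIV n))"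
    using from_nat_into_surj[OF assms(1) UNIV_I] by (intro ext) metis
  moreover have "Measurable.pred M (\<lambda>\<omega>. \<exists>n::nat. P \<omega> (from_nat_into UNIV n))"
    by (intro pred_intros_countable assms(2))
  ultimately show ?thesis by (simp only:)
qed

lemma pred_all_countable:
  assumes "countable (UNIV :: 'v set)" "\<And>v::'v. Measurable.pred M (\<lambda>\<omega>. P \<omega> v)"
  shows "Measurable.pred M (\<lambda>\<omega>. \<forall>v. P \<omega> v)"
proof -
  have "Measurable.pred M (\<lambda>\<omega>. \<not> (\<exists>v. \<not> P \<omega> v))"
    by (intro pred_intros_logic(2) pred_ex_countable[OF assms(1)] assms(2))
  then show ?thesis by (simp only: not_ex not_not)
qed

definition off :: "('v set \<Rightarrow> bool) \<Rightarrow> 'v set \<Rightarrow> 'v set \<Rightarrow> bool" where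
  "off f A = (\<lambda>e. f e \<and> e \<inter> A = {})"

text \<open>The state of the boundary edge itself is deliberately left out. The set is thus
  determined by edges that do not meet \<open>A\<close>, and opening any one of its members joins
  \<open>A\<close> to \<open>B\<close>.\<close>

definition exits :: "('v \<Rightarrow> 'v \<Rightarrow> bool) \<Rightarrow> ('v set \<Rightarrow> bool) \<Rightarrow> 'v set \<Rightarrow> 'v set \<Rightarrow> 'v set set" where
  "exits adj f A B = {e. \<exists>a a'. e = {a, a'} \<and> adj a a' \<and> a \<in> A \<and> a' \<notin> A \<and>
     (\<exists>b\<in>B. open_conn adj (off f A) a' b)}"

definition edges_at :: "('v \<Rightarrow> 'v \<Rightarrow> bool) \<Rightarrow> 'v set \<Rightarrow> 'v set set" where
  "edges_at adj A = {e \<in> graph_edges adj. e \<inter> A \<noteq> {}}"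

lemma edgeI: "adj u v \<Longrightarrow> {u, v} \<in> graph_edges adj"
  by (auto simp: graph_edges_def)

lemma open_conn_refl [simp]: "open_conn adj f u u"
  by (simp add: open_conn_def)

lemma open_conn_trans: "open_conn adj f u v \<Longrightarrow> open_conn adj f v w \<Longrightarrow> open_conn adj f u w"
  unfolding open_conn_def by (rule rtranclp_trans)

lemma open_conn_edge: "adj u v \<Longrightarrow> f {u, v} \<Longrightarrow> open_conn adj f u v"
  unfolding open_conn_def by blast

lemma open_conn_mono:
  assumes "open_conn adj f u v" "\<And>e. e \<in> graph_edges adj \<Longrightarrow> f e \<Longrightarrow> g e"
  shows "open_conn adj g u v"
  using assms(1) unfolding open_conn_def
  by (rule rtranclp_mono[THEN predicate2D, rotated]) (auto intro: assms(2) edgeI)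

lemma open_conn_cong:
  assumes "\<And>e. e \<in> graph_edges adj \<Longrightarrow> f e = g e"
  shows "open_conn adj f = open_conn adj g"
  by (intro ext iffI) (auto elim!: open_conn_mono simp: assms)

lemma open_conn_induct [consumes 1, case_names base step]:
  assumes "open_conn adj f u v" "P u"
    "\<And>y z. open_conn adj f u y \<Longrightarrow> adj y z \<Longrightarrow> f {y, z} \<Longrightarrow> P y \<Longrightarrow> P z"
  shows "P v"
  using assms unfolding open_conn_def by (rule rtranclp_induct[where P=P]) blast+

lemma open_conn_converse_induct [consumes 1, case_names base step]:
  assumes "open_conn adj f u v" "P v"
    "\<And>y z. adj y z \<Longrightarrow> f {y, z} \<Longrightarrow> open_conn adj f z v \<Longrightarrow> P z \<Longrightarrow> P y"
  shows "P u"
  using assms unfolding open_conn_def by (rule converse_rtranclp_induct[where P=P]) blast+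

lemma self_in_cluster [simp]: "x \<in> cluster adj f x"
  by (simp add: cluster_def)

lemma cluster_mono:
  "(\<And>e. e \<in> graph_edges adj \<Longrightarrow> f e \<Longrightarrow> g e) \<Longrightarrow> cluster adj f x \<subseteq> cluster adj g x"
  by (auto simp: cluster_def intro: open_conn_mono)

text \<open>Exploring a cluster inspects only edges that touch it: a path of \<open>g\<close>
  started at \<open>x\<close> can leave \<open>A\<close> only through an edge at \<open>A\<close>,
  where \<open>f\<close> and \<open>g\<close> agree.\<close>

lemma cluster_eq_local:
  assumes A: "cluster adj f x = A"
    and eq: "\<And>e. e \<in> edges_at adj A \<Longrightarrow> f e = g e"
  shows "cluster adj g x = A"
proof -
  have "v \<in> A" if "open_conn adj g x v" for v
    using that
  proof (induction rule: open_conn_induct)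
    case base
    then show ?case using A by auto
  next
    case (step y z)
    then have "f {y, z}" using eq[of "{y, z}"] by (auto simp: edges_at_def edgeI)
    then have "open_conn adj f y z" using step.hyps(2) open_conn_edge[of adj y z f] by blast
    moreover have "open_conn adj f x y" using step A by (auto simp: cluster_def)
    ultimately show ?case using A by (auto simp: cluster_def intro: open_conn_trans)
  qed
  moreover have "open_conn adj g x v" if "open_conn adj f x v" for v
    using that
  proof (induction rule: open_conn_induct)
    case (step y z)
    then have "y \<in> A" using A by (auto simp: cluster_def)
    then have "g {y, z}" using eq[of "{y, z}"] step by (auto simp: edges_at_def edgeI)
    then show ?case using step by (meson open_conn_edge open_conn_trans)
  qed simp
  ultimately show ?thesis using A by (auto simp: cluster_def)
qed

lemma exits_subset: "exits adj f A B \<subseteq> edges_at adj A"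
  by (auto simp: exits_def edges_at_def graph_edges_def)

lemma exits_cong:
  assumes "\<And>e. e \<in> graph_edges adj \<Longrightarrow> e \<inter> A = {} \<Longrightarrow> f e = g e"
  shows "exits adj f A B = exits adj g A B"
proof -
  have "open_conn adj (off f A) = open_conn adj (off g A)"
    using assms by (intro open_conn_cong) (auto simp: off_def)
  then show ?thesis by (simp add: exits_def)
qed

text \<open>On an open path from \<open>A\<close> to \<open>B\<close>, the last edge that leaves
  \<open>A\<close> is an open exit, since the path avoids \<open>A\<close> afterwards.\<close>

lemma connects_iff_exits:
  assumes "A \<inter> B = {}"
  shows "f \<in> connects adj A B \<longleftrightarrow> (\<exists>e\<in>exits adj f A B. f e)"
proof
  assume "f \<in> connects adj A B"
  then obtain a b where ab: "a \<in> A" "b \<in> B" "open_conn adj f a b"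
    by (auto simp: connects_def)
  \<comment> \<open>The path is read backwards from \<open>b\<close>. Until an open exit is met, the
    part read so far avoids \<open>A\<close>; at the starting point \<open>a \<in> A\<close> this
    alternative is impossible.\<close>
  have "(\<exists>e\<in>exits adj f A B. f e) \<or> (a \<notin> A \<and> open_conn adj (off f A) a b)"
    using ab(3)
  proof (induction rule: open_conn_converse_induct)
    case base
    then show ?case using assms ab by auto
  next
    case (step y z)
    show ?case
    proof (cases "\<exists>e\<in>exits adj f A B. f e")
      case False
      with step have z: "z \<notin> A" "open_conn adj (off f A) z b" by auto
      have "y \<notin> A"
      proof
        assume "y \<in> A"
        then have "{y, z} \<in> exits adj f A B"
          using z step ab by (auto simp: exits_def)
        with False step show False by auto
      qed
      moreover from this have "open_conn adj (off f A) y z"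
        using z step by (intro open_conn_edge) (auto simp: off_def)
      ultimately show ?thesis using z by (auto intro: open_conn_trans)
    qed simp
  qed
  then show "\<exists>e\<in>exits adj f A B. f e" using ab by auto
next
  assume "\<exists>e\<in>exits adj f A B. f e"
  then obtain a a' b where *: "f {a, a'}" "adj a a'" "a \<in> A" "b \<in> B" "open_conn adj (off f A) a' b"
    by (auto simp: exits_def)
  have "open_conn adj f a' b" using *(5) by (rule open_conn_mono) (auto simp: off_def)
  with * show "f \<in> connects adj A B"
    unfolding connects_def by (blast intro: open_conn_trans open_conn_edge)
qed

lemma cluster_within: "cluster adj (\<lambda>e. f e \<and> e \<subseteq> \<Lambda>) x \<subseteq> insert x \<Lambda>"
proof
  fix v assume "v \<in> cluster adj (\<lambda>e. f e \<and> e \<subseteq> \<Lambda>) x"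
  then have "open_conn adj (\<lambda>e. f e \<and> e \<subseteq> \<Lambda>) x v" by (simp add: cluster_def)
  then show "v \<in> insert x \<Lambda>" by (induction rule: open_conn_induct) auto
qed

lemma edges_at_subset: "edges_at adj A \<subseteq> graph_edges adj"
  by (auto simp: edges_at_def)

text \<open>Finite neighbourhoods keep the boundary of a finite set finite. Nonemptiness of the edge
  set is recorded because independence is characterised by product laws over a nonempty index
  set.\<close>

locale perc_graph =
  fixes adj :: "'v \<Rightarrow> 'v \<Rightarrow> bool"
  assumes adj_sym: "adj u v \<Longrightarrow> adj v u"
    and countable_vertices: "countable (UNIV :: 'v set)"
    and infinite_vertices: "infinite (UNIV :: 'v set)"
    and finite_nbrs: "finite {u. adj v u}"
    and edges_nonempty: "graph_edges adj \<noteq> {}"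
begin

lemma open_conn_sym: "open_conn adj f u v \<Longrightarrow> open_conn adj f v u"
proof (induction rule: open_conn_induct)
  case (step y z)
  then have "open_conn adj f z y"
    by (intro open_conn_edge adj_sym[of y z]) (simp_all add: insert_commute)
  then show ?case using step by (auto intro: open_conn_trans)
qed simp

lemma connects_commute: "connects adj A B = connects adj B A"
  unfolding connects_def using open_conn_sym by blast

lemma cluster_eq: "open_conn adj f x y \<Longrightarrow> cluster adj f x = cluster adj f y"
  unfolding cluster_def
  by (intro Collect_cong iffI) (blast intro: open_conn_trans open_conn_sym)+

lemma finite_edges_at: "finite A \<Longrightarrow> finite (edges_at adj A)"
proof -
  assume "finite A"
  moreover have "edges_at adj A \<subseteq> (\<Union>a\<in>A. (\<lambda>u. {a, u}) ` {u. adj a u})"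
  proof
    fix e assume "e \<in> edges_at adj A"
    then obtain u v where e: "e = {u, v}" "adj u v" "u \<in> A \<or> v \<in> A"
      by (auto simp: edges_at_def graph_edges_def)
    moreover have "e = {v, u}" "adj v u"
      using e adj_sym[of u v] by auto
    ultimately show "e \<in> (\<Union>a\<in>A. (\<lambda>u. {a, u}) ` {u. adj a u})"
      by blast
  qed
  ultimately show ?thesis
    by (elim finite_subset) (intro finite_UN_I finite_imageI finite_nbrs)
qed

section \<open>Exhaustion of the vertices by finite windows\<close>

definition initial :: "nat \<Rightarrow> 'v set" where
  "initial n = from_nat_into UNIV ` {..<n}"

lemma finite_initial [simp]: "finite (initial n)"
  by (simp add: initial_def)

lemma initial_mono: "m \<le> n \<Longrightarrow> initial m \<subseteq> initial n"
  by (auto simp: initial_def)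

lemma finite_subset_initial: "finite S \<Longrightarrow> \<exists>n. S \<subseteq> initial n"
proof (induction rule: finite_induct)
  case (insert x S)
  then obtain n where n: "S \<subseteq> initial n" by auto
  obtain m where "x = from_nat_into UNIV m"
    by (metis UNIV_I countable_vertices from_nat_into_surj)
  then have "x \<in> initial (Suc m)" by (auto simp: initial_def)
  then have "insert x S \<subseteq> initial (max n (Suc m))"
    using n initial_mono[of n "max n (Suc m)"] initial_mono[of "Suc m" "max n (Suc m)"] by auto
  then show ?case by blast
qed simp

section \<open>Measurability of percolation events\<close>

text \<open>A connection is a countable union over path lengths, and each further step is a
  countable union over the intermediate vertex.\<close>

lemma pred_open_conn:
  assumes f: "\<And>e. e \<in> graph_edges adj \<Longrightarrow> Measurable.pred M (\<lambda>\<omega>. f \<omega> e)"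
  shows "Measurable.pred M (\<lambda>\<omega>. open_conn adj (f \<omega>) u v)"
proof -
  define step where "step \<omega> = (\<lambda>u v. adj u v \<and> f \<omega> {u, v})" for \<omega>
  have step: "Measurable.pred M (\<lambda>\<omega>. step \<omega> u v)" for u v
  proof (cases "adj u v")
    case True
    have "{u, v} \<in> graph_edges adj"
      using True by (auto simp: graph_edges_def)
    from f[OF this] show ?thesis
      by (simp only: step_def True simp_thms)
  next
    case False
    show ?thesis
      by (simp only: step_def False simp_thms pred_constant)
  qed
  have "Measurable.pred M (\<lambda>\<omega>. (step \<omega> ^^ n) u v)" for n v
  proof (induction n arbitrary: v)
    case (Suc n)
    have "Measurable.pred M (\<lambda>\<omega>. \<exists>w. (step \<omega> ^^ n) u w \<and> step \<omega> w v)"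
      by (intro pred_ex_countable[OF countable_vertices] pred_intros_logic(2-4,6) Suc step)
    then show ?case by (simp only: relpowp.simps relcompp_apply)
  qed (simp only: relpowp.simps pred_constant)
  then have "Measurable.pred M (\<lambda>\<omega>. \<exists>n. (step \<omega> ^^ n) u v)"
    by (rule pred_intros_countable)
  then show ?thesis
    by (simp only: open_conn_def rtranclp_power step_def[symmetric])
qed

lemma pred_exits:
  assumes f: "\<And>e. e \<in> graph_edges adj \<Longrightarrow> Measurable.pred M (\<lambda>\<omega>. f \<omega> e)"
  shows "Measurable.pred M (\<lambda>\<omega>. e \<in> exits adj (f \<omega>) A B)"
proof -
  have "Measurable.pred M (\<lambda>\<omega>. \<exists>a a' b. (e = {a, a'} \<and> adj a a' \<and> a \<in> A \<and> a' \<notin> A \<and> b \<in> B) \<and>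
     open_conn adj (off (f \<omega>) A) a' b)"
    using f by (intro pred_ex_countable[OF countable_vertices] pred_intros_logic(2-4,6) pred_constant pred_open_conn)
      (auto simp: off_def)
  also have "(\<lambda>\<omega>. \<exists>a a' b. (e = {a, a'} \<and> adj a a' \<and> a \<in> A \<and> a' \<notin> A \<and> b \<in> B) \<and>
     open_conn adj (off (f \<omega>) A) a' b) = (\<lambda>\<omega>. e \<in> exits adj (f \<omega>) A B)"
    by (intro ext) (auto simp: exits_def)
  finally show ?thesis .
qed

lemma pred_connects:
  assumes f: "\<And>e. e \<in> graph_edges adj \<Longrightarrow> Measurable.pred M (\<lambda>\<omega>. f \<omega> e)"
  shows "Measurable.pred M (\<lambda>\<omega>. f \<omega> \<in> connects adj A B)"
proof -
  have "Measurable.pred M (\<lambda>\<omega>. \<exists>a b. (a \<in> A \<and> b \<in> B) \<and> open_conn adj (f \<omega>) a b)"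
    using f by (intro pred_ex_countable[OF countable_vertices] pred_intros_logic(2-4,6) pred_constant pred_open_conn)
  also have "(\<lambda>\<omega>. \<exists>a b. (a \<in> A \<and> b \<in> B) \<and> open_conn adj (f \<omega>) a b) = (\<lambda>\<omega>. f \<omega> \<in> connects adj A B)"
    by (intro ext) (auto simp: connects_def)
  finally show ?thesis .
qed

lemma pred_cluster_eq:
  assumes f: "\<And>e. e \<in> graph_edges adj \<Longrightarrow> Measurable.pred M (\<lambda>\<omega>. f \<omega> e)"
  shows "Measurable.pred M (\<lambda>\<omega>. cluster adj (f \<omega>) x = A)"
proof -
  have "Measurable.pred M (\<lambda>\<omega>. \<forall>v. open_conn adj (f \<omega>) x v \<longleftrightarrow> v \<in> A)"
    using f by (intro pred_all_countable[OF countable_vertices] pred_intros_logic(2-4,6) pred_constant pred_open_conn)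
  also have "(\<lambda>\<omega>. \<forall>v. open_conn adj (f \<omega>) x v \<longleftrightarrow> v \<in> A) = (\<lambda>\<omega>. cluster adj (f \<omega>) x = A)"
    by (intro ext) (auto simp: cluster_def)
  finally show ?thesis .
qed

lemma infinite_iff_initial: "infinite S \<longleftrightarrow> (\<forall>n. \<exists>v. v \<in> S \<and> v \<notin> initial n)"
proof -
  have "finite S \<longleftrightarrow> (\<exists>n. S \<subseteq> initial n)"
    using finite_subset_initial[of S] by (auto intro: finite_subset[OF _ finite_initial])
  then show ?thesis by blast
qed

lemma pred_infinite_cluster:
  assumes f: "\<And>e. e \<in> graph_edges adj \<Longrightarrow> Measurable.pred M (\<lambda>\<omega>. f \<omega> e)"
  shows "Measurable.pred M (\<lambda>\<omega>. infinite (cluster adj (f \<omega>) x))"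
proof -
  have "Measurable.pred M (\<lambda>\<omega>. \<forall>n::nat. \<exists>v. open_conn adj (f \<omega>) x v \<and> v \<notin> initial n)"
    using f by (intro pred_all_countable[OF countableI_type] pred_ex_countable[OF countable_vertices]
      pred_intros_logic(3) pred_constant pred_open_conn)
  then show ?thesis
    by (simp only: infinite_iff_initial cluster_def mem_Collect_eq)
qed

lemma unique_infinite_cluster_iff:
  "unique_infinite_cluster adj f \<longleftrightarrow> (\<exists>x. infinite (cluster adj f x) \<and>
     (\<forall>y. infinite (cluster adj f y) \<longrightarrow> open_conn adj f x y))"
proof -
  have "cluster adj f y = cluster adj f x \<longleftrightarrow> open_conn adj f x y" for x y
    using cluster_eq[of f x y] self_in_cluster[of y adj f] by (metis cluster_def mem_Collect_eq)
  then show ?thesis by (simp only: unique_infinite_cluster_def)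
qed

lemma pred_unique_infinite_cluster:
  assumes f: "\<And>e. e \<in> graph_edges adj \<Longrightarrow> Measurable.pred M (\<lambda>\<omega>. f \<omega> e)"
  shows "Measurable.pred M (\<lambda>\<omega>. unique_infinite_cluster adj (f \<omega>))"
  unfolding unique_infinite_cluster_iff
  by (intro pred_all_countable[OF countable_vertices] pred_ex_countable[OF countable_vertices]
     pred_intros_logic(3,4) pred_open_conn[OF f] pred_infinite_cluster[OF f])

text \<open>The exits lie in the finite set \<open>edges_at adj A\<close>, so the event is a finite
  union over the possible values of the set of exits.\<close>

lemma pred_exits_bounded:
  assumes A: "finite A" and f: "\<And>e. e \<in> graph_edges adj \<Longrightarrow> Measurable.pred M (\<lambda>\<omega>. f \<omega> e)"
  shows "Measurable.pred M (\<lambda>\<omega>. card (exits adj (f \<omega>) A B) < k)"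
proof -
  have "Measurable.pred M (\<lambda>\<omega>. \<exists>S\<in>{S\<in>Pow (edges_at adj A). card S < k}. \<forall>e\<in>edges_at adj A. e \<in> exits adj (f \<omega>) A B \<longleftrightarrow> e \<in> S)"
    by (intro pred_intros_finite(3,4) pred_intros_logic(6) pred_constant pred_exits[OF f] finite_edges_at[OF A])
       (simp add: finite_edges_at[OF A])
  also have "(\<lambda>\<omega>. \<exists>S\<in>{S\<in>Pow (edges_at adj A). card S < k}. \<forall>e\<in>edges_at adj A. e \<in> exits adj (f \<omega>) A B \<longleftrightarrow> e \<in> S) =
     (\<lambda>\<omega>. card (exits adj (f \<omega>) A B) < k)"
  proof (rule ext)
    fix \<omega>
    have "(\<forall>e\<in>edges_at adj A. e \<in> exits adj (f \<omega>) A B \<longleftrightarrow> e \<in> S) \<longleftrightarrow> exits adj (f \<omega>) A B = S"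
      if "S \<subseteq> edges_at adj A" for S
      using that exits_subset[of adj "f \<omega>" A B] by blast
    then show "(\<exists>S\<in>{S\<in>Pow (edges_at adj A). card S < k}. \<forall>e\<in>edges_at adj A. e \<in> exits adj (f \<omega>) A B \<longleftrightarrow> e \<in> S) =
       (card (exits adj (f \<omega>) A B) < k)"
      using exits_subset[of adj "f \<omega>" A B] by auto
  qed
  finally show ?thesis .
qed

section \<open>Exploration of clusters inside finite windows\<close>

lemma open_conn_within_initial:
  assumes "open_conn adj f x v"
  shows "\<exists>m. open_conn adj (\<lambda>e. f e \<and> e \<subseteq> initial m) x v"
  using assms
proof (induction rule: open_conn_induct)
  case (step y z)
  then obtain m where m: "open_conn adj (\<lambda>e. f e \<and> e \<subseteq> initial m) x y" by blast
  obtain m' where m': "{y, z} \<subseteq> initial m'" using finite_subset_initial[of "{y, z}"] by auto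
  have "open_conn adj (\<lambda>e. f e \<and> e \<subseteq> initial (max m m')) x y"
    using m by (rule open_conn_mono) (use initial_mono[of m "max m m'"] in auto)
  moreover have "open_conn adj (\<lambda>e. f e \<and> e \<subseteq> initial (max m m')) y z"
    using step m' initial_mono[of m' "max m m'"] by (intro open_conn_edge) auto
  ultimately show ?case by (blast intro: open_conn_trans)
qed auto

lemma explored_cluster_mono:
  "m \<le> m' \<Longrightarrow> cluster adj (\<lambda>e. f e \<and> e \<subseteq> initial m) x \<subseteq> cluster adj (\<lambda>e. f e \<and> e \<subseteq> initial m') x"
  by (rule cluster_mono) (use initial_mono in blast)

lemma finite_explored: "finite (cluster adj (\<lambda>e. f e \<and> e \<subseteq> initial m) x)"
  by (rule finite_subset[OF cluster_within]) simp

text \<open>Any \<open>n\<close> vertices of the infinite cluster are reached by finitely many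
  finite paths, which fit into a common window.\<close>

lemma explored_card_unbounded:
  assumes "infinite (cluster adj f x)"
  shows "\<exists>m. n \<le> card (cluster adj (\<lambda>e. f e \<and> e \<subseteq> initial m) x)"
proof -
  obtain U where U: "finite U" "card U = n" "U \<subseteq> cluster adj f x"
    using infinite_arbitrarily_large[OF assms] by blast
  from U(1,3) have "\<exists>m. U \<subseteq> cluster adj (\<lambda>e. f e \<and> e \<subseteq> initial m) x"
  proof (induction rule: finite_induct)
    case (insert u U)
    then obtain m where m: "U \<subseteq> cluster adj (\<lambda>e. f e \<and> e \<subseteq> initial m) x" by auto
    obtain m' where m': "u \<in> cluster adj (\<lambda>e. f e \<and> e \<subseteq> initial m') x"
      using open_conn_within_initial[of f x u] insert.prems by (auto simp: cluster_def)
    have "insert u U \<subseteq> cluster adj (\<lambda>e. f e \<and> e \<subseteq> initial (max m m')) x"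
      using m m' explored_cluster_mono[of m "max m m'" f x] explored_cluster_mono[of m' "max m m'" f x]
      by auto
    then show ?case by blast
  qed auto
  then obtain m where "U \<subseteq> cluster adj (\<lambda>e. f e \<and> e \<subseteq> initial m) x" by blast
  then have "card U \<le> card (cluster adj (\<lambda>e. f e \<and> e \<subseteq> initial m) x)"
    by (intro card_mono finite_explored)
  with U(2) show ?thesis by blast
qed

lemma pred_card_explored:
  assumes \<Lambda>: "finite \<Lambda>" and f: "\<And>e. e \<in> graph_edges adj \<Longrightarrow> Measurable.pred M (\<lambda>\<omega>. f \<omega> e)"
  shows "Measurable.pred M (\<lambda>\<omega>. n \<le> card (cluster adj (\<lambda>e. f \<omega> e \<and> e \<subseteq> \<Lambda>) x))"
proof -
  have "Measurable.pred M (\<lambda>\<omega>. \<exists>A\<in>{A\<in>Pow (insert x \<Lambda>). n \<le> card A}. cluster adj (\<lambda>e. f \<omega> e \<and> e \<subseteq> \<Lambda>) x = A)"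
    by (intro pred_intros_finite(4) pred_cluster_eq pred_intros_logic(3) pred_constant f) (simp_all add: \<Lambda>)
  also have "(\<lambda>\<omega>. \<exists>A\<in>{A\<in>Pow (insert x \<Lambda>). n \<le> card A}. cluster adj (\<lambda>e. f \<omega> e \<and> e \<subseteq> \<Lambda>) x = A) =
     (\<lambda>\<omega>. n \<le> card (cluster adj (\<lambda>e. f \<omega> e \<and> e \<subseteq> \<Lambda>) x))"
    using cluster_within[of adj] by (intro ext) blast
  finally show ?thesis .
qed

end

subsection \<open>Coupling by three layers\<close>

locale perc_coupling = perc_graph adj for adj :: "'v \<Rightarrow> 'v \<Rightarrow> bool" +
  fixes p0 s1 s2 :: real
  assumes p0: "0 < p0" "p0 < 1" and s1: "0 < s1" "s1 < 1" and s2: "0 < s2" "s2 \<le> 1"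
begin

definition rate :: "nat \<Rightarrow> real" where
  "rate j = (if j = 0 then p0 else if j = 1 then s1 else s2)"

definition coords :: "('v set \<times> nat) set" where
  "coords = graph_edges adj \<times> {0, 1, 2}"

definition coupling :: "('v set \<times> nat \<Rightarrow> bool) measure" where
  "coupling = bern coords (\<lambda>i. rate (snd i))"

definition layers :: "nat set \<Rightarrow> ('v set \<times> nat \<Rightarrow> bool) \<Rightarrow> 'v set \<Rightarrow> bool" where
  "layers L \<omega> e \<longleftrightarrow> (\<exists>j\<in>L. \<omega> (e, j))"

lemma rate_bounds: "0 \<le> rate j \<and> rate j \<le> 1"
  using p0 s1 s2 by (auto simp: rate_def)

lemma prob_space_coupling: "prob_space coupling"
  unfolding coupling_def by (rule prob_space_bern)

sublocale prob_space coupling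
  by (rule prob_space_coupling)

lemma pred_coord: "e \<in> graph_edges adj \<Longrightarrow> j \<in> {0, 1, 2} \<Longrightarrow> Measurable.pred coupling (\<lambda>\<omega>. \<omega> (e, j))"
  unfolding coupling_def by (rule bern_coord_measurable) (simp add: coords_def)

lemma layers_mono: "L \<subseteq> L' \<Longrightarrow> layers L \<omega> e \<Longrightarrow> layers L' \<omega> e"
  by (auto simp: layers_def)

lemma pred_layers:
  assumes "L \<subseteq> {0, 1, 2}" "e \<in> graph_edges adj"
  shows "Measurable.pred coupling (\<lambda>\<omega>. layers L \<omega> e)"
  unfolding layers_def
proof (rule pred_intros_finite)
  show "finite L" using assms(1) by (rule finite_subset) simp
  fix j assume "j \<in> L"
  then show "Measurable.pred coupling (\<lambda>\<omega>. \<omega> (e, j))"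
    using assms by (intro pred_coord) auto
qed

text \<open>An edge is closed in the union of the layers iff it is closed in each of them, which
  explains the product in the hypothesis. Distinct edges use disjoint blocks of coordinates and are
  therefore independent.\<close>

lemma distr_layers:
  assumes L: "L \<subseteq> {0, 1, 2}" and p: "0 \<le> p" "p \<le> 1" "(\<Prod>j\<in>L. 1 - rate j) = 1 - p"
  shows "distr coupling (perc adj p) (\<lambda>\<omega>. \<lambda>e\<in>graph_edges adj. layers L \<omega> e) = perc adj p"
proof -
  let ?E = "graph_edges adj" and ?q = "\<lambda>i. rate (snd i)"
  let ?B = "measure_pmf (bernoulli_pmf p)"
  let ?M = "\<lambda>i. measure_pmf (bernoulli_pmf (?q i))"
  have finL: "finite L" using L by (rule finite_subset) simp
  have ne: "coords \<noteq> {}" using edges_nonempty by (auto simp: coords_def)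
  \<comment> \<open>The state of \<open>e\<close> reads only the block
    \<open>{e} \<times> L\<close>, so independence of disjoint blocks passes to the states of the
    edges.\<close>
  have rv: "layers L' \<omega> e = layers L' (restrict \<omega> ({e} \<times> L')) e" for L' \<omega> e
    by (auto simp: layers_def)
  have lay: "(\<lambda>\<omega>. layers L \<omega> e) \<in> coupling \<rightarrow>\<^sub>M ?B" if "e \<in> ?E" for e
    using pred_layers[OF L that] by (simp only: measurable_pmf_measure2)
  have "indep_vars ?M (\<lambda>i \<omega>. \<omega> i) coords"
    unfolding coupling_def by (rule indep_vars_bern_coord[OF ne])
  then have "indep_vars (\<lambda>e. PiM ({e} \<times> L) ?M) (\<lambda>e \<omega>. restrict (\<lambda>i. \<omega> i) ({e} \<times> L)) ?E"
    by (rule indep_vars_restrict) (use L in \<open>auto simp: coords_def disjoint_family_on_def\<close>)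
  then have "indep_vars (\<lambda>_. ?B) (\<lambda>e \<omega>. layers L (restrict (\<lambda>i. \<omega> i) ({e} \<times> L)) e) ?E"
  proof (rule indep_vars_compose2)
    fix e assume "e \<in> ?E"
    have "Measurable.pred (bern ({e} \<times> L) ?q) (\<lambda>\<omega>. \<exists>j\<in>L. \<omega> (e, j))"
      by (intro pred_intros_finite finL bern_coord_measurable) simp
    then show "(\<lambda>\<omega>. layers L \<omega> e) \<in> PiM ({e} \<times> L) ?M \<rightarrow>\<^sub>M ?B"
      by (simp only: bern_def layers_def measurable_pmf_measure2)
  qed
  then have "indep_vars (\<lambda>_. ?B) (\<lambda>e \<omega>. layers L \<omega> e) ?E"
    by (simp only: rv[symmetric] eta_contract_eq)
  then have "distr coupling (PiM ?E (\<lambda>_. ?B)) (\<lambda>\<omega>. \<lambda>e\<in>?E. layers L \<omega> e) =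
      PiM ?E (\<lambda>e. distr coupling ?B (\<lambda>\<omega>. layers L \<omega> e))"
    by (subst (asm) indep_vars_iff_distr_eq_PiM'[OF edges_nonempty lay])
  also have "\<dots> = PiM ?E (\<lambda>_. ?B)"
  proof (intro PiM_cong refl)
    fix e assume e: "e \<in> ?E"
    have "{\<omega>\<in>space coupling. \<not> layers L \<omega> e} = {\<omega>\<in>space coupling. \<forall>i\<in>{e} \<times> L. \<not> \<omega> i}"
      by (auto simp: layers_def)
    then have "prob {\<omega>\<in>space coupling. \<not> layers L \<omega> e} = (\<Prod>i\<in>{e} \<times> L. 1 - ?q i)"
      unfolding coupling_def using e L finL rate_bounds
      by (simp only:) (intro bern_all_closed, auto simp: coords_def)
    also have "\<dots> = (\<Prod>j\<in>L. 1 - rate j)"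
    proof -
      have "{e} \<times> L = Pair e ` L" by auto
      then show ?thesis by (simp add: prod.reindex inj_on_def)
    qed
    finally have F: "prob {\<omega>\<in>space coupling. \<not> layers L \<omega> e} = 1 - p"
      using p(3) by simp
    have T: "prob {\<omega>\<in>space coupling. layers L \<omega> e} = p"
      using prob_neg[OF predE[OF pred_layers[OF L e]]] F by simp
    show "distr coupling ?B (\<lambda>\<omega>. layers L \<omega> e) = ?B"
    proof (rule measure_eqI_finite[of _ UNIV])
      fix b :: bool
      have "(\<lambda>\<omega>. layers L \<omega> e) -` {b} \<inter> space coupling = {\<omega>\<in>space coupling. layers L \<omega> e = b}"
        by auto
      note * = this
      have "emeasure (distr coupling ?B (\<lambda>\<omega>. layers L \<omega> e)) {b} =
          emeasure coupling ((\<lambda>\<omega>. layers L \<omega> e) -` {b} \<inter> space coupling)"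
        by (rule emeasure_distr[OF lay[OF e]]) simp
      also have "\<dots> = ennreal (prob {\<omega>\<in>space coupling. layers L \<omega> e = b})"
        by (simp only: * emeasure_eq_measure)
      also have "\<dots> = ennreal (measure ?B {b})"
        using F T p by (cases b) (simp_all add: measure_pmf_single)
      finally show "emeasure (distr coupling ?B (\<lambda>\<omega>. layers L \<omega> e)) {b} = emeasure ?B {b}"
        by (simp add: measure_pmf.emeasure_eq_measure)
    qed simp_all
  qed
  finally show ?thesis
    by (simp add: perc_def)
qed

text \<open>Carries the connectivity hypothesis at \<open>p0\<close> over to layer 0 of the
  coupling.\<close>

lemma prob_disconnected_perc:
  "measure (perc adj p0) (space (perc adj p0) - connects adj A B) =
    prob {\<omega>\<in>space coupling. layers {0} \<omega> \<notin> connects adj A B}"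
proof -
  let ?f = "\<lambda>\<omega>. \<lambda>e\<in>graph_edges adj. layers {0} \<omega> e"
  have eq: "distr coupling (perc adj p0) ?f = perc adj p0"
    using p0 by (intro distr_layers) (auto simp: rate_def)
  have meas: "?f \<in> coupling \<rightarrow>\<^sub>M perc adj p0"
    unfolding perc_eq_bern by (intro measurable_bernI pred_layers) auto
  have "Measurable.pred (perc adj p0) (\<lambda>f. f \<notin> connects adj A B)"
    unfolding perc_eq_bern by (intro pred_intros_logic(2) pred_connects bern_coord_measurable)
  then have "{f\<in>space (perc adj p0). f \<notin> connects adj A B} \<in> sets (perc adj p0)"
    by (rule predE)
  then have S: "space (perc adj p0) - connects adj A B \<in> sets (perc adj p0)"
    by (simp only: set_diff_eq)
  have con: "?f \<omega> \<in> connects adj A B \<longleftrightarrow> layers {0} \<omega> \<in> connects adj A B" for \<omega>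
  proof -
    have "open_conn adj (?f \<omega>) = open_conn adj (layers {0} \<omega>)"
      by (intro open_conn_cong) simp
    then show ?thesis by (simp add: connects_def)
  qed
  have "measure (perc adj p0) (space (perc adj p0) - connects adj A B) =
     measure (distr coupling (perc adj p0) ?f) (space (perc adj p0) - connects adj A B)"
    by (simp only: eq)
  also have "\<dots> = prob (?f -` (space (perc adj p0) - connects adj A B) \<inter> space coupling)"
    by (rule measure_distr[OF meas S])
  also have "?f -` (space (perc adj p0) - connects adj A B) \<inter> space coupling =
     {\<omega>\<in>space coupling. layers {0} \<omega> \<notin> connects adj A B}"
    using measurable_space[OF meas] con by blast
  finally show ?thesis .
qed

subsection \<open>Boundary edges with fresh randomness\<close>

text \<open>At \<^term>\<open>B\<close> layer 1 replaces layer 0, because the latter has been used up in exploring \<^term>\<open>B\<close>.\<close>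

definition fresh :: "'v set \<Rightarrow> ('v set \<times> nat \<Rightarrow> bool) \<Rightarrow> 'v set \<Rightarrow> bool" where
  "fresh B \<omega> e = (if e \<inter> B = {} then \<omega> (e, 0) else \<omega> (e, 1))"

lemma pred_fresh: "e \<in> graph_edges adj \<Longrightarrow> Measurable.pred coupling (\<lambda>\<omega>. fresh B \<omega> e)"
  unfolding fresh_def by (cases "e \<inter> B = {}") (auto intro: pred_coord)

text \<open>The tag \<open>h e\<close> names the layer in which the edge \<open>e\<close> is tested.
  Tagging turns random sets of edges into random sets of coordinates, to which the stopping-set
  estimates apply.\<close>

lemma pred_tagged_image:
  assumes "\<And>e. e \<in> graph_edges adj \<Longrightarrow> Measurable.pred coupling (\<lambda>\<omega>. e \<in> T \<omega>)"
    and "i \<in> (\<lambda>e. (e, h e)) ` F" and "F \<subseteq> graph_edges adj"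
  shows "Measurable.pred coupling (\<lambda>\<omega>. i \<in> (\<lambda>e. (e, h e)) ` T \<omega>)"
proof -
  obtain e where e: "e \<in> F" "i = (e, h e)" using assms(2) by auto
  then have "(\<lambda>\<omega>. i \<in> (\<lambda>e. (e, h e)) ` T \<omega>) = (\<lambda>\<omega>. e \<in> T \<omega>)" by auto
  then show ?thesis using assms(1)[of e] assms(3) e by auto
qed

lemma card_tagged: "card ((\<lambda>e. (e, h e)) ` T) = card T"
  by (intro card_image) (auto simp: inj_on_def)

text \<open>The exits read \<open>f\<close> only off \<open>A\<close>, and there \<open>f\<close>
  uses no coordinate of an edge at \<open>A\<close>. Every layer of the edges at \<open>A\<close> is
  therefore still unexplored, and the two random set estimates apply with the layer
  \<open>h e\<close> of each exit.\<close>

lemma exits_closed_prob: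
  fixes f :: "('v set \<times> nat \<Rightarrow> bool) \<Rightarrow> 'v set \<Rightarrow> bool"
  assumes A: "finite A" and h: "\<And>e. h e \<in> {0, 1, 2}"
    and f: "\<And>e. e \<in> graph_edges adj \<Longrightarrow> Measurable.pred coupling (\<lambda>\<omega>. f \<omega> e)"
    and loc: "\<And>e \<omega> \<omega>'. e \<in> graph_edges adj \<Longrightarrow> e \<inter> A = {} \<Longrightarrow> (\<And>j. j \<in> {0, 1, 2} \<Longrightarrow> \<omega> (e, j) = \<omega>' (e, j)) \<Longrightarrow> f \<omega> e = f \<omega>' e"
  shows "(\<And>e. e \<in> edges_at adj A \<Longrightarrow> s \<le> rate (h e)) \<Longrightarrow> 0 \<le> s \<Longrightarrow> s \<le> 1 \<Longrightarrow>
      prob {\<omega>\<in>space coupling. k \<le> card (exits adj (f \<omega>) A B) \<and> (\<forall>e\<in>exits adj (f \<omega>) A B. \<not> \<omega> (e, h e))} \<le> (1 - s) ^ k"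
    and "(\<And>e. e \<in> edges_at adj A \<Longrightarrow> c \<le> 1 - rate (h e)) \<Longrightarrow> 0 \<le> c \<Longrightarrow> c \<le> 1 \<Longrightarrow>
      c ^ k * prob {\<omega>\<in>space coupling. card (exits adj (f \<omega>) A B) < k} \<le>
      prob {\<omega>\<in>space coupling. \<forall>e\<in>exits adj (f \<omega>) A B. \<not> \<omega> (e, h e)}"
proof -
  let ?t = "\<lambda>e. (e, h e)"
  define T where "T \<omega> = ?t ` exits adj (f \<omega>) A B" for \<omega>
  define F where "F = ?t ` edges_at adj A"
  have q: "0 \<le> rate (snd i) \<and> rate (snd i) \<le> 1" for i :: "'v set \<times> nat"
    by (rule rate_bounds)
  have F: "finite F" "F \<subseteq> coords"
  proof -
    show "finite F" unfolding F_def using finite_edges_at[OF A] by simp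
    show "F \<subseteq> coords" unfolding F_def coords_def
      by (intro image_subsetI SigmaI h subsetD[OF edges_at_subset])
  qed
  have TF: "T \<omega> \<subseteq> F" for \<omega>
    unfolding T_def F_def by (intro image_mono exits_subset)
  have meas: "Measurable.pred coupling (\<lambda>\<omega>. i \<in> T \<omega>)" if "i \<in> F" for i
    unfolding T_def using that
    by (intro pred_tagged_image[where F="edges_at adj A"] pred_exits f edges_at_subset) (auto simp: F_def)
  have local: "depends_on (coords - S) (\<lambda>\<omega>. T \<omega> = S)" if "S \<subseteq> F" for S
  proof (rule depends_onI)
    fix \<omega> \<omega>' :: "'v set \<times> nat \<Rightarrow> bool"
    assume eq: "\<And>i. i \<in> coords - S \<Longrightarrow> \<omega> i = \<omega>' i"
    have "f \<omega> e = f \<omega>' e" if e: "e \<in> graph_edges adj" "e \<inter> A = {}" for e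
    proof (rule loc[OF e])
      fix j :: nat assume "j \<in> {0, 1, 2}"
      moreover have "(e, j) \<notin> S"
        using \<open>S \<subseteq> F\<close> e(2) by (auto simp: F_def edges_at_def)
      ultimately show "\<omega> (e, j) = \<omega>' (e, j)"
        using e(1) by (intro eq) (simp add: coords_def)
    qed
    then have "exits adj (f \<omega>) A B = exits adj (f \<omega>') A B"
      by (rule exits_cong)
    then show "(T \<omega> = S) = (T \<omega>' = S)" by (simp add: T_def)
  qed
  note rs = q F TF meas[unfolded coupling_def] local
  have Tc: "card (T \<omega>) = card (exits adj (f \<omega>) A B)" for \<omega>
    unfolding T_def by (rule card_tagged)
  have Tb: "(\<forall>i\<in>T \<omega>. \<not> \<omega> i) = (\<forall>e\<in>exits adj (f \<omega>) A B. \<not> \<omega> (e, h e))" for \<omega>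
    by (simp add: T_def)
  show "prob {\<omega>\<in>space coupling. k \<le> card (exits adj (f \<omega>) A B) \<and> (\<forall>e\<in>exits adj (f \<omega>) A B. \<not> \<omega> (e, h e))} \<le> (1 - s) ^ k"
    if "\<And>e. e \<in> edges_at adj A \<Longrightarrow> s \<le> rate (h e)" "0 \<le> s" "s \<le> 1"
    unfolding Tc[symmetric] Tb[symmetric] unfolding coupling_def
    by (rule bern_large_random_set_closed_le[OF rs]) (use that in \<open>auto simp: F_def\<close>)
  show "c ^ k * prob {\<omega>\<in>space coupling. card (exits adj (f \<omega>) A B) < k} \<le>
      prob {\<omega>\<in>space coupling. \<forall>e\<in>exits adj (f \<omega>) A B. \<not> \<omega> (e, h e)}"
    if "\<And>e. e \<in> edges_at adj A \<Longrightarrow> c \<le> 1 - rate (h e)" "0 \<le> c" "c \<le> 1"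
    unfolding Tc[symmetric] Tb[symmetric] unfolding coupling_def
    by (rule bern_small_random_set_closed_ge[OF rs]) (use that in \<open>auto simp: F_def\<close>)
qed

text \<open>Layer 0 and \<open>fresh B\<close> agree off \<open>B\<close>, so both have the same set
  \<open>N\<close> of exits from \<open>B\<close> towards \<open>A\<close>. A set \<open>N\<close>
  with fewer than \<open>k\<close> edges is entirely closed in layer 0 at a price of at most
  \<open>(1 - p0) ^ k\<close>, which bounds the probability that \<open>N\<close> is small. If
  \<open>N\<close> has at least \<open>k\<close> edges, layer 1 opens one of them except with
  probability \<open>(1 - s1) ^ k\<close>.\<close>

lemma fresh_disconnected_le:
  assumes A: "finite A" and B: "finite B" and AB: "A \<inter> B = {}"
  shows "prob {\<omega>\<in>space coupling. fresh B \<omega> \<notin> connects adj A B} \<le>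
     prob {\<omega>\<in>space coupling. layers {0} \<omega> \<notin> connects adj A B} / (1 - p0) ^ k + (1 - s1) ^ k"
proof -
  define N where "N \<omega> = exits adj (layers {0} \<omega>) B A" for \<omega>
  have loc: "layers {0} \<omega> e = layers {0} \<omega>' e"
    if "\<And>j. j \<in> {0, 1, 2} \<Longrightarrow> \<omega> (e, j) = \<omega>' (e, j)" for e \<omega> \<omega>'
    using that[of 0] by (simp add: layers_def)
  have lay: "Measurable.pred coupling (\<lambda>\<omega>. layers {0} \<omega> e)" if "e \<in> graph_edges adj" for e
    using that by (intro pred_layers) auto
  have N: "exits adj (fresh B \<omega>) B A = N \<omega>" for \<omega>
    unfolding N_def by (rule exits_cong) (auto simp: fresh_def layers_def)
  have AB': "B \<inter> A = {}" using AB by auto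
  have c0: "layers {0} \<omega> \<notin> connects adj A B \<longleftrightarrow> (\<forall>e\<in>N \<omega>. \<not> \<omega> (e, 0))" for \<omega>
    unfolding connects_commute[of A B] connects_iff_exits[OF AB'] N_def by (auto simp: layers_def)
  have c1: "fresh B \<omega> \<notin> connects adj A B \<longleftrightarrow> (\<forall>e\<in>N \<omega>. \<not> \<omega> (e, 1))" for \<omega>
  proof -
    have "e \<inter> B \<noteq> {}" if "e \<in> N \<omega>" for e
      using that exits_subset[of adj _ B A] by (auto simp: N_def edges_at_def)
    then show ?thesis
      unfolding connects_commute[of A B] connects_iff_exits[OF AB'] N by (auto simp: fresh_def)
  qed
  have "(1 - p0) ^ k * prob {\<omega>\<in>space coupling. card (N \<omega>) < k} \<le>
      prob {\<omega>\<in>space coupling. \<forall>e\<in>N \<omega>. \<not> \<omega> (e, 0)}"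
    unfolding N_def using p0 B by (intro exits_closed_prob(2)[where h="\<lambda>_. 0"] lay loc) (auto simp: rate_def)
  then have small: "prob {\<omega>\<in>space coupling. card (N \<omega>) < k} \<le>
      prob {\<omega>\<in>space coupling. layers {0} \<omega> \<notin> connects adj A B} / (1 - p0) ^ k"
    using p0 by (simp add: c0 field_simps)
  have large: "prob {\<omega>\<in>space coupling. k \<le> card (N \<omega>) \<and> (\<forall>e\<in>N \<omega>. \<not> \<omega> (e, 1))} \<le> (1 - s1) ^ k"
    unfolding N_def using s1 B by (intro exits_closed_prob(1)[where h="\<lambda>_. 1"] lay loc) (auto simp: rate_def)
  have m1: "Measurable.pred coupling (\<lambda>\<omega>. card (N \<omega>) < k)"
    unfolding N_def by (rule pred_exits_bounded[OF B lay])
  have "Measurable.pred coupling (\<lambda>\<omega>. \<not> card (N \<omega>) < k \<and> fresh B \<omega> \<notin> connects adj A B)"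
    by (intro pred_intros_logic(2,3) m1 pred_connects pred_fresh)
  then have m2: "{\<omega>\<in>space coupling. k \<le> card (N \<omega>) \<and> (\<forall>e\<in>N \<omega>. \<not> \<omega> (e, 1))} \<in> events"
    using predE by (simp only: c1 not_less)
  have "prob {\<omega>\<in>space coupling. fresh B \<omega> \<notin> connects adj A B} \<le>
     prob ({\<omega>\<in>space coupling. card (N \<omega>) < k} \<union> {\<omega>\<in>space coupling. k \<le> card (N \<omega>) \<and> (\<forall>e\<in>N \<omega>. \<not> \<omega> (e, 1))})"
    using c1 by (intro finite_measure_mono sets.Un predE[OF m1] m2) auto
  also have "\<dots> \<le> prob {\<omega>\<in>space coupling. card (N \<omega>) < k} + prob {\<omega>\<in>space coupling. k \<le> card (N \<omega>) \<and> (\<forall>e\<in>N \<omega>. \<not> \<omega> (e, 1))}"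
    by (intro measure_Un_le predE[OF m1] m2)
  finally show ?thesis using small large by linarith
qed

text \<open>The boundary argument again, now at \<open>A\<close>: an exit is tested in layer 0 or,
  if it meets \<open>B\<close>, in layer 1, so closing it has probability at least the minimum of
  \<open>1 - p0\<close> and \<open>1 - s1\<close>.\<close>

lemma few_fresh_exits_le:
  assumes A: "finite A" and AB: "A \<inter> B = {}"
  shows "min (1 - p0) (1 - s1) ^ k * prob {\<omega>\<in>space coupling. card (exits adj (fresh B \<omega>) A B) < k} \<le>
     prob {\<omega>\<in>space coupling. fresh B \<omega> \<notin> connects adj A B}"
proof -
  have "fresh B \<omega> \<notin> connects adj A B \<longleftrightarrow>
      (\<forall>e\<in>exits adj (fresh B \<omega>) A B. \<not> \<omega> (e, if e \<inter> B = {} then 0 else 1))" for \<omega>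
    unfolding connects_iff_exits[OF AB] by (auto simp: fresh_def)
  moreover have "min (1 - p0) (1 - s1) ^ k * prob {\<omega>\<in>space coupling. card (exits adj (fresh B \<omega>) A B) < k} \<le>
     prob {\<omega>\<in>space coupling. \<forall>e\<in>exits adj (fresh B \<omega>) A B. \<not> \<omega> (e, if e \<inter> B = {} then 0 else 1)}"
    using p0 s1 A by (intro exits_closed_prob(2) pred_fresh) (auto simp: rate_def fresh_def)
  ultimately show ?thesis by simp
qed

subsection \<open>Exploration and sprinkling\<close>

abbreviation explored_top :: "'v set \<Rightarrow> 'v \<Rightarrow> ('v set \<times> nat \<Rightarrow> bool) \<Rightarrow> 'v set" where
  "explored_top \<Lambda> x \<omega> \<equiv> cluster adj (\<lambda>e. layers {0, 1, 2} \<omega> e \<and> e \<subseteq> \<Lambda>) x"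

abbreviation explored_bot :: "'v set \<Rightarrow> 'v \<Rightarrow> ('v set \<times> nat \<Rightarrow> bool) \<Rightarrow> 'v set" where
  "explored_bot \<Lambda> y \<omega> \<equiv> cluster adj (\<lambda>e. layers {0} \<omega> e \<and> e \<subseteq> \<Lambda>) y"

text \<open>The exploration of \<^term>\<open>A\<close> and \<^term>\<open>B\<close> inspects all layers of the edges at \<^term>\<open>A\<close> and
layer 0 of the remaining edges at \<^term>\<open>B\<close>, none of which enters the fresh configuration off \<^term>\<open>A\<close>.\<close>

lemma exploration_indep:
  assumes A: "finite A"
  shows "prob {\<omega>\<in>space coupling. (explored_top \<Lambda> x \<omega> = A \<and>
        explored_bot \<Lambda> y \<omega> = B) \<and> card (exits adj (fresh B \<omega>) A B) < k} =
     prob {\<omega>\<in>space coupling. explored_top \<Lambda> x \<omega> = A \<and>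
        explored_bot \<Lambda> y \<omega> = B} *
     prob {\<omega>\<in>space coupling. card (exits adj (fresh B \<omega>) A B) < k}"
proof -
  define J where "J = {(e, j)\<in>coords. e \<inter> A \<noteq> {} \<or> (e \<inter> B \<noteq> {} \<and> j = 0)}"
  define K where "K = {(e, j)\<in>coords. e \<inter> A = {} \<and> j = (if e \<inter> B = {} then 0 else 1)}"
  have JK: "J \<subseteq> coords" "K \<subseteq> coords" "J \<inter> K = {}"
    by (auto simp: J_def K_def split: if_splits)
  \<comment> \<open>Clusters depend only on the edges at them, so agreement on \<open>J\<close>
    preserves both explored values. The converse follows by exchanging the two
    configurations.\<close>
  have imp: "explored_top \<Lambda> x \<omega>' = A \<and> explored_bot \<Lambda> y \<omega>' = B"
    if eq: "\<And>i. i \<in> J \<Longrightarrow> \<omega> i = \<omega>' i"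
      and cl: "explored_top \<Lambda> x \<omega> = A \<and> explored_bot \<Lambda> y \<omega> = B"
    for \<omega> \<omega>'
  proof
    have "layers {0, 1, 2} \<omega> e = layers {0, 1, 2} \<omega>' e" if "e \<in> edges_at adj A" for e
    proof -
      have "\<omega> (e, j) = \<omega>' (e, j)" if "j \<in> {0, 1, 2}" for j
        using \<open>e \<in> edges_at adj A\<close> that by (intro eq) (auto simp: J_def coords_def edges_at_def)
      then show ?thesis unfolding layers_def by (intro bex_cong refl)
    qed
    then show "explored_top \<Lambda> x \<omega>' = A"
      by (intro cluster_eq_local[OF conjunct1[OF cl]]) simp
    have "\<omega> (e, 0) = \<omega>' (e, 0)" if "e \<in> edges_at adj B" for e
      using that by (intro eq) (auto simp: J_def coords_def edges_at_def)
    then show "explored_bot \<Lambda> y \<omega>' = B"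
      by (intro cluster_eq_local[OF conjunct2[OF cl]]) (simp add: layers_def)
  qed
  have dJ: "depends_on J (\<lambda>\<omega>. explored_top \<Lambda> x \<omega> = A \<and>
        explored_bot \<Lambda> y \<omega> = B)"
  proof (rule depends_onI)
    fix \<omega> \<omega>' :: "'v set \<times> nat \<Rightarrow> bool"
    assume eq: "\<And>i. i \<in> J \<Longrightarrow> \<omega> i = \<omega>' i"
    show "(explored_top \<Lambda> x \<omega> = A \<and> explored_bot \<Lambda> y \<omega> = B) =
      (explored_top \<Lambda> x \<omega>' = A \<and> explored_bot \<Lambda> y \<omega>' = B)"
      using imp[of \<omega> \<omega>'] imp[of \<omega>' \<omega>] eq by (intro iffI) (simp_all only:)
  qed
  have dK: "depends_on K (\<lambda>\<omega>. card (exits adj (fresh B \<omega>) A B) < k)"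
  proof (rule depends_onI)
    fix \<omega> \<omega>' :: "'v set \<times> nat \<Rightarrow> bool"
    assume eq: "\<And>i. i \<in> K \<Longrightarrow> \<omega> i = \<omega>' i"
    have "fresh B \<omega> e = fresh B \<omega>' e" if "e \<in> graph_edges adj" "e \<inter> A = {}" for e
      using that eq[of "(e, 0)"] eq[of "(e, 1)"]
      by (cases "e \<inter> B = {}") (simp_all add: K_def coords_def fresh_def)
    then have "exits adj (fresh B \<omega>) A B = exits adj (fresh B \<omega>') A B"
      by (rule exits_cong)
    then show "(card (exits adj (fresh B \<omega>) A B) < k) = (card (exits adj (fresh B \<omega>') A B) < k)"
      by simp
  qed
  have m1: "Measurable.pred coupling (\<lambda>\<omega>. explored_top \<Lambda> x \<omega> = A \<and>
        explored_bot \<Lambda> y \<omega> = B)"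
    by (intro pred_intros_logic(3) pred_cluster_eq pred_layers pred_constant) simp_all
  have m2: "Measurable.pred coupling (\<lambda>\<omega>. card (exits adj (fresh B \<omega>) A B) < k)"
    by (intro pred_exits_bounded[OF A] pred_fresh)
  show ?thesis
    using m1 m2 unfolding coupling_def by (rule bern_indep[OF _ _ dJ dK JK])
qed

text \<open>The cluster of \<^term>\<open>x\<close> is taken off the cluster of \<^term>\<open>y\<close>, so that layer 2 of the contact edges
is never inspected.\<close>

definition contacts :: "'v \<Rightarrow> 'v \<Rightarrow> ('v set \<times> nat \<Rightarrow> bool) \<Rightarrow> 'v set set" where
  "contacts x y \<omega> = {e. \<exists>a a'. e = {a, a'} \<and> adj a a' \<and> a' \<in> cluster adj (layers {0, 1} \<omega>) y \<and>
     a \<in> cluster adj (off (layers {0, 1, 2} \<omega>) (cluster adj (layers {0, 1} \<omega>) y)) x}"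

text \<open>The cluster of \<open>y\<close> reads layers 0 and 1 only, and the cluster of
  \<open>x\<close> is explored along edges that miss it. Every contact edge meets the cluster of
  \<open>y\<close>, so altering layer 2 on contacts changes neither cluster.\<close>

lemma contacts_local:
  assumes eq: "\<And>i. i \<in> coords - (\<lambda>e. (e, 2)) ` (contacts x y \<omega> \<inter> F) \<Longrightarrow> \<omega> i = \<omega>' i"
  shows "contacts x y \<omega>' = contacts x y \<omega>"
proof -
  have e01: "\<omega> (e, j) = \<omega>' (e, j)" if "e \<in> graph_edges adj" "j \<in> {0, 1}" for e j
    using that by (intro eq) (auto simp: coords_def)
  have "open_conn adj (layers {0, 1} \<omega>) = open_conn adj (layers {0, 1} \<omega>')"
    using e01 by (intro open_conn_cong) (simp add: layers_def)
  then have D: "cluster adj (layers {0, 1} \<omega>') y = cluster adj (layers {0, 1} \<omega>) y"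
    by (simp add: cluster_def)
  let ?D = "cluster adj (layers {0, 1} \<omega>) y"
  have "off (layers {0, 1, 2} \<omega>) ?D e = off (layers {0, 1, 2} \<omega>') ?D e" if e: "e \<in> graph_edges adj" for e
  proof (cases "e \<inter> ?D = {}")
    case True
    then have "e \<notin> contacts x y \<omega>" by (auto simp: contacts_def)
    then have "\<omega> (e, 2) = \<omega>' (e, 2)" using e by (intro eq) (auto simp: coords_def)
    then show ?thesis using e01[OF e] by (simp add: off_def layers_def)
  qed (simp add: off_def)
  then have "open_conn adj (off (layers {0, 1, 2} \<omega>) ?D) = open_conn adj (off (layers {0, 1, 2} \<omega>') ?D)"
    by (rule open_conn_cong)
  then have "cluster adj (off (layers {0, 1, 2} \<omega>') ?D) x = cluster adj (off (layers {0, 1, 2} \<omega>) ?D) x"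
    by (simp only: cluster_def)
  then show ?thesis by (simp only: contacts_def D)
qed

lemma pred_contacts: "Measurable.pred coupling (\<lambda>\<omega>. e \<in> contacts x y \<omega>)"
proof -
  have "Measurable.pred coupling (\<lambda>\<omega>. \<exists>a a'. (e = {a, a'} \<and> adj a a') \<and> open_conn adj (layers {0, 1} \<omega>) y a' \<and>
     open_conn adj (\<lambda>e. layers {0, 1, 2} \<omega> e \<and> (\<forall>v. v \<in> e \<longrightarrow> \<not> open_conn adj (layers {0, 1} \<omega>) y v)) x a)"
    by (intro pred_ex_countable[OF countable_vertices] pred_all_countable[OF countable_vertices]
      pred_intros_logic(2-4) pred_open_conn pred_layers pred_constant) auto
  also have "(\<lambda>\<omega>. \<exists>a a'. (e = {a, a'} \<and> adj a a') \<and> open_conn adj (layers {0, 1} \<omega>) y a' \<and>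
     open_conn adj (\<lambda>e. layers {0, 1, 2} \<omega> e \<and> (\<forall>v. v \<in> e \<longrightarrow> \<not> open_conn adj (layers {0, 1} \<omega>) y v)) x a) =
     (\<lambda>\<omega>. e \<in> contacts x y \<omega>)"
    by (simp add: contacts_def cluster_def off_def disjoint_iff conj_assoc)
  finally show ?thesis .
qed

text \<open>Intersecting with the finite set \<open>F\<close> makes the stopping-set estimate
  applicable, as the set of all contacts may be infinite.\<close>

lemma many_contacts_closed_le:
  assumes F: "finite F" "F \<subseteq> graph_edges adj"
  shows "prob {\<omega>\<in>space coupling. k \<le> card (contacts x y \<omega> \<inter> F) \<and> (\<forall>e\<in>contacts x y \<omega> \<inter> F. \<not> \<omega> (e, 2))} \<le> (1 - s2) ^ k"
    and "{\<omega>\<in>space coupling. k \<le> card (contacts x y \<omega> \<inter> F) \<and> (\<forall>e\<in>contacts x y \<omega> \<inter> F. \<not> \<omega> (e, 2))} \<in> events"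
proof -
  let ?t = "\<lambda>e::'v set. (e, 2::nat)"
  define T where "T \<omega> = ?t ` (contacts x y \<omega> \<inter> F)" for \<omega>
  have meas: "Measurable.pred coupling (\<lambda>\<omega>. i \<in> T \<omega>)" if "i \<in> ?t ` F" for i
    unfolding T_def
  proof (rule pred_tagged_image[OF _ that F(2)])
    show "Measurable.pred coupling (\<lambda>\<omega>. e \<in> contacts x y \<omega> \<inter> F)" for e
      unfolding Int_iff by (intro pred_intros_logic(3) pred_contacts pred_constant)
  qed
  have local: "depends_on (coords - S) (\<lambda>\<omega>. T \<omega> = S)" for S
  proof (rule depends_onI)
    fix \<omega> \<omega>' :: "'v set \<times> nat \<Rightarrow> bool"
    assume eq: "\<And>i. i \<in> coords - S \<Longrightarrow> \<omega> i = \<omega>' i"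
    have 1: "T \<omega>' = S" if "T \<omega> = S"
      using contacts_local[of x y \<omega> F \<omega>'] eq that by (simp add: T_def)
    have 2: "T \<omega> = S" if "T \<omega>' = S"
      using contacts_local[of x y \<omega>' F \<omega>] eq that by (simp add: T_def)
    show "(T \<omega> = S) = (T \<omega>' = S)" using 1 2 by blast
  qed
  have q: "0 \<le> rate (snd i) \<and> rate (snd i) \<le> 1" for i :: "'v set \<times> nat"
    by (rule rate_bounds)
  have tF: "finite (?t ` F)" "?t ` F \<subseteq> coords"
    using F by (auto simp: coords_def)
  have TF: "T \<omega> \<subseteq> ?t ` F" for \<omega> by (auto simp: T_def)
  have Tc: "card (contacts x y \<omega> \<inter> F) = card (T \<omega>)" for \<omega>
    unfolding T_def by (rule card_tagged[symmetric])
  have Tb: "(\<forall>e\<in>contacts x y \<omega> \<inter> F. \<not> \<omega> (e, 2)) = (\<forall>i\<in>T \<omega>. \<not> \<omega> i)" for \<omega>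
    by (simp add: T_def)
  show "prob {\<omega>\<in>space coupling. k \<le> card (contacts x y \<omega> \<inter> F) \<and> (\<forall>e\<in>contacts x y \<omega> \<inter> F. \<not> \<omega> (e, 2))} \<le> (1 - s2) ^ k"
    unfolding Tc Tb unfolding coupling_def
    by (rule bern_large_random_set_closed_le[OF q tF TF meas[unfolded coupling_def] local])
       (use s2 in \<open>auto simp: rate_def\<close>)
  have TS: "Measurable.pred coupling (\<lambda>\<omega>. T \<omega> = S)" for S
    unfolding coupling_def
    by (rule bern_random_set(3)[OF q tF TF meas[unfolded coupling_def] local])
  have "Measurable.pred coupling (\<lambda>\<omega>. \<exists>S\<in>{S\<in>Pow (?t ` F). k \<le> card S}. T \<omega> = S \<and> (\<forall>i\<in>S. \<not> \<omega> i))"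
  proof (intro pred_intros_finite(3,4) pred_intros_logic(2,3) TS)
    show "finite {S\<in>Pow (?t ` F). k \<le> card S}" using tF by simp
    fix S assume S: "S \<in> {S\<in>Pow (?t ` F). k \<le> card S}"
    then show "finite S" using tF(1) by (auto intro: finite_subset)
    fix i assume "i \<in> S"
    with S tF(2) have "i \<in> coords" by auto
    then show "Measurable.pred coupling (\<lambda>\<omega>. \<omega> i)"
      unfolding coupling_def by (rule bern_coord_measurable)
  qed
  also have "(\<lambda>\<omega>. \<exists>S\<in>{S\<in>Pow (?t ` F). k \<le> card S}. T \<omega> = S \<and> (\<forall>i\<in>S. \<not> \<omega> i)) =
     (\<lambda>\<omega>. k \<le> card (T \<omega>) \<and> (\<forall>i\<in>T \<omega>. \<not> \<omega> i))"
    using TF by (intro ext) blast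
  finally show "{\<omega>\<in>space coupling. k \<le> card (contacts x y \<omega> \<inter> F) \<and> (\<forall>e\<in>contacts x y \<omega> \<inter> F. \<not> \<omega> (e, 2))} \<in> events"
    unfolding Tc Tb by (rule predE)
qed

text \<open>The deterministic core. If \<open>x\<close> and \<open>y\<close> are separated in all
  layers, an exit from \<open>A\<close> leads to the cluster \<open>D\<close> of \<open>y\<close> in
  layers 0 and 1, because \<open>fresh B\<close> opens no edge that these layers close. It is
  therefore a contact, and a contact open in layer 2 would join \<open>x\<close> to
  \<open>y\<close>.\<close>

lemma disconnected_cases:
  assumes nc: "\<not> open_conn adj (layers {0, 1, 2} \<omega>) x y"
    and A: "A = explored_top \<Lambda> x \<omega>" and B: "B = explored_bot \<Lambda> y \<omega>"
  shows "A \<inter> B = {}"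
    and "exits adj (fresh B \<omega>) A B \<subseteq> contacts x y \<omega> \<inter> edges_at adj (insert x \<Lambda>)"
    and "\<forall>e\<in>contacts x y \<omega>. \<not> \<omega> (e, 2)"
proof -
  let ?W = "layers {0, 1, 2} \<omega>"
  define D where "D = cluster adj (layers {0, 1} \<omega>) y"
  have A_W: "A \<subseteq> cluster adj ?W x"
    unfolding A by (rule cluster_mono) simp
  have B_D: "B \<subseteq> D"
    unfolding B D_def by (rule cluster_mono) (auto intro: layers_mono[of "{0}"])
  have D_W: "D \<subseteq> cluster adj ?W y"
    unfolding D_def by (rule cluster_mono) (auto intro: layers_mono[of "{0, 1}"])
  have xy: "cluster adj ?W x \<inter> cluster adj ?W y = {}"
  proof (rule ccontr)
    assume "cluster adj ?W x \<inter> cluster adj ?W y \<noteq> {}"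
    then obtain v where "open_conn adj ?W x v" "open_conn adj ?W y v"
      by (auto simp: cluster_def)
    then have "open_conn adj ?W x y"
      by (meson open_conn_sym open_conn_trans)
    with nc show False ..
  qed
  then show "A \<inter> B = {}" using A_W B_D D_W by blast
  have W_step: "v \<in> cluster adj ?W x" if "u \<in> cluster adj ?W x" "adj u v" "?W {u, v}" for u v
    using that open_conn_edge[of adj u v ?W] open_conn_trans[of adj ?W x u v] by (simp add: cluster_def)
  \<comment> \<open>An open edge at the full cluster of \<open>x\<close> has both ends in that
    cluster, hence misses \<open>D\<close>. Deleting the edges at \<open>D\<close> therefore leaves
    the cluster of \<open>x\<close> unchanged.\<close>
  have offD: "cluster adj (off ?W D) x = cluster adj ?W x"
  proof (rule cluster_eq_local[OF refl])
    fix e assume "e \<in> edges_at adj (cluster adj ?W x)"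
    then obtain u v where uv: "e = {u, v}" "adj u v" "u \<in> cluster adj ?W x"
      unfolding edges_at_def graph_edges_def using adj_sym by (auto simp: insert_commute)
    show "?W e = off ?W D e"
    proof (cases "?W e")
      case True
      then have "v \<in> cluster adj ?W x" using uv W_step by simp
      then have "e \<inter> D = {}" using uv xy D_W by blast
      then show ?thesis by (simp add: off_def)
    qed (simp add: off_def)
  qed
  show "\<forall>e\<in>contacts x y \<omega>. \<not> \<omega> (e, 2)"
  proof
    fix e assume "e \<in> contacts x y \<omega>"
    then obtain a a' where e: "e = {a, a'}" "adj a a'" "a' \<in> D" "a \<in> cluster adj ?W x"
      unfolding contacts_def D_def[symmetric] offD by blast
    show "\<not> \<omega> (e, 2)"
    proof
      assume "\<omega> (e, 2)"
      then have "?W {a, a'}" using e(1) by (auto simp: layers_def)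
      then have "a' \<in> cluster adj ?W x" by (rule W_step[OF e(4,2)])
      then show False using e(3) xy D_W by blast
    qed
  qed
  show "exits adj (fresh B \<omega>) A B \<subseteq> contacts x y \<omega> \<inter> edges_at adj (insert x \<Lambda>)"
  proof
    fix e assume ex: "e \<in> exits adj (fresh B \<omega>) A B"
    have "A \<subseteq> insert x \<Lambda>" unfolding A by (rule cluster_within)
    then have "e \<in> edges_at adj (insert x \<Lambda>)"
      using ex exits_subset[of adj "fresh B \<omega>" A B] by (auto simp: edges_at_def)
    moreover obtain a a' b where e: "e = {a, a'}" "adj a a'" "a \<in> A" "b \<in> B"
        "open_conn adj (off (fresh B \<omega>) A) a' b"
      using ex by (auto simp: exits_def)
    have "open_conn adj (layers {0, 1} \<omega>) a' b"
      using e(5) by (rule open_conn_mono) (auto simp: off_def fresh_def layers_def split: if_splits)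
    moreover have "open_conn adj (layers {0, 1} \<omega>) y b"
      using e(4) B_D by (auto simp: D_def cluster_def)
    ultimately have "a' \<in> D"
      unfolding D_def cluster_def mem_Collect_eq by (meson open_conn_sym open_conn_trans)
    then have "e \<in> contacts x y \<omega>"
      unfolding contacts_def D_def[symmetric] offD using e A_W by blast
    with \<open>e \<in> edges_at adj (insert x \<Lambda>)\<close> show "e \<in> contacts x y \<omega> \<inter> edges_at adj (insert x \<Lambda>)"
      by simp
  qed
qed

text \<open>Either the fresh exits number fewer than \<open>k\<close>, which has probability at most
  \<open>\<epsilon>\<close> independently of the explored pair, or at least \<open>k\<close>
  contacts exist and layer 2 is closed on all of them. The bound does not depend on the
  window.\<close>

lemma explored_disconnected_le:
  assumes \<Lambda>: "finite \<Lambda>" and \<epsilon>: "0 \<le> \<epsilon>"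
    and few: "\<And>A B. finite A \<Longrightarrow> finite B \<Longrightarrow> A \<inter> B = {} \<Longrightarrow> n \<le> card A \<Longrightarrow> n \<le> card B \<Longrightarrow>
      prob {\<omega>\<in>space coupling. card (exits adj (fresh B \<omega>) A B) < k} \<le> \<epsilon>"
  shows "prob {\<omega>\<in>space coupling. \<not> open_conn adj (layers {0, 1, 2} \<omega>) x y \<and>
      n \<le> card (explored_top \<Lambda> x \<omega>) \<and> n \<le> card (explored_bot \<Lambda> y \<omega>)} \<le> \<epsilon> + (1 - s2) ^ k"
proof -
  define P where "P = {(A, B). A \<subseteq> insert x \<Lambda> \<and> B \<subseteq> insert y \<Lambda> \<and> A \<inter> B = {} \<and> n \<le> card A \<and> n \<le> card B}"
  define E where "E = (\<lambda>(A, B). {\<omega>\<in>space coupling. explored_top \<Lambda> x \<omega> = A \<and> explored_bot \<Lambda> y \<omega> = B})"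
  define E' where "E' = (\<lambda>(A, B). {\<omega>\<in>space coupling. (explored_top \<Lambda> x \<omega> = A \<and> explored_bot \<Lambda> y \<omega> = B) \<and>
      card (exits adj (fresh B \<omega>) A B) < k})"
  define F where "F = edges_at adj (insert x \<Lambda>)"
  define C where "C = {\<omega>\<in>space coupling. k \<le> card (contacts x y \<omega> \<inter> F) \<and> (\<forall>e\<in>contacts x y \<omega> \<inter> F. \<not> \<omega> (e, 2))}"
  have "P \<subseteq> Pow (insert x \<Lambda>) \<times> Pow (insert y \<Lambda>)" by (auto simp: P_def)
  then have finP: "finite P" by (rule finite_subset) (simp add: \<Lambda>)
  have finAB: "finite A" "finite B" if "(A, B) \<in> P" for A B
    using that finite_subset[of A "insert x \<Lambda>"] finite_subset[of B "insert y \<Lambda>"] \<Lambda> by (simp_all add: P_def)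
  have F: "finite F" "F \<subseteq> graph_edges adj"
    unfolding F_def using \<Lambda> by (simp_all only: finite_edges_at finite_insert edges_at_subset)
  have m1: "Measurable.pred coupling (\<lambda>\<omega>. explored_top \<Lambda> x \<omega> = A \<and> explored_bot \<Lambda> y \<omega> = B)" for A B
    by (intro pred_intros_logic(3) pred_cluster_eq pred_layers pred_constant) simp_all
  have E: "E ab \<in> events" for ab
  proof (cases ab)
    case (Pair A B)
    show ?thesis unfolding Pair E_def split by (rule predE[OF m1])
  qed
  have E': "E' ab \<in> events" if "ab \<in> P" for ab
  proof -
    obtain A B where ab: "ab = (A, B)" by (cases ab)
    with that have "finite A" using finAB by blast
    then have "Measurable.pred coupling (\<lambda>\<omega>. (explored_top \<Lambda> x \<omega> = A \<and> explored_bot \<Lambda> y \<omega> = B) \<and>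
      card (exits adj (fresh B \<omega>) A B) < k)"
      by (intro pred_intros_logic(3)[OF m1] pred_exits_bounded pred_fresh)
    from predE[OF this] show ?thesis by (simp only: E'_def ab split)
  qed
  have C: "C \<in> events" "prob C \<le> (1 - s2) ^ k"
    unfolding C_def by (rule many_contacts_closed_le[OF F])+
  have sub: "{\<omega>\<in>space coupling. \<not> open_conn adj (layers {0, 1, 2} \<omega>) x y \<and>
      n \<le> card (explored_top \<Lambda> x \<omega>) \<and> n \<le> card (explored_bot \<Lambda> y \<omega>)} \<subseteq> (\<Union>ab\<in>P. E' ab) \<union> C"
  proof
    fix \<omega> assume "\<omega> \<in> {\<omega>\<in>space coupling. \<not> open_conn adj (layers {0, 1, 2} \<omega>) x y \<and>
      n \<le> card (explored_top \<Lambda> x \<omega>) \<and> n \<le> card (explored_bot \<Lambda> y \<omega>)}"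
    then have \<omega>: "\<omega> \<in> space coupling" and nc: "\<not> open_conn adj (layers {0, 1, 2} \<omega>) x y"
      and n: "n \<le> card (explored_top \<Lambda> x \<omega>)" "n \<le> card (explored_bot \<Lambda> y \<omega>)" by auto
    define A where "A = explored_top \<Lambda> x \<omega>"
    define B where "B = explored_bot \<Lambda> y \<omega>"
    note cases = disconnected_cases[OF nc A_def B_def]
    have "(A, B) \<in> P"
      unfolding P_def mem_Collect_eq split
      by (intro conjI cases(1)) (simp_all only: n A_def B_def cluster_within)
    show "\<omega> \<in> (\<Union>ab\<in>P. E' ab) \<union> C"
    proof (cases "card (exits adj (fresh B \<omega>) A B) < k")
      case True
      then have "\<omega> \<in> E' (A, B)" using \<omega> by (simp add: E'_def A_def B_def)
      with \<open>(A, B) \<in> P\<close> show ?thesis by blast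
    next
      case False
      have "card (exits adj (fresh B \<omega>) A B) \<le> card (contacts x y \<omega> \<inter> F)"
        unfolding F_def by (rule card_mono[OF _ cases(2)]) (use F in \<open>simp add: F_def\<close>)
      then have "\<omega> \<in> C" using False \<omega> cases(3) by (simp add: C_def)
      then show ?thesis ..
    qed
  qed
  have "prob (\<Union>ab\<in>P. E' ab) \<le> (\<Sum>ab\<in>P. prob (E' ab))"
    by (rule finite_measure_subadditive_finite[OF finP]) (use E' in blast)
  \<comment> \<open>Independence gives the factor \<open>prob (E ab)\<close>. These events are
    disjoint, so the weights sum to at most 1 and the number of possible pairs does not
    enter.\<close>
  also have "\<dots> \<le> (\<Sum>ab\<in>P. prob (E ab) * \<epsilon>)"
  proof (rule sum_mono)
    fix ab assume ab: "ab \<in> P"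
    obtain A B where AB: "ab = (A, B)" by (cases ab)
    have "prob (E' ab) = prob (E ab) * prob {\<omega>\<in>space coupling. card (exits adj (fresh B \<omega>) A B) < k}"
      unfolding E_def E'_def AB split by (rule exploration_indep) (use finAB ab AB in blast)
    also have "\<dots> \<le> prob (E ab) * \<epsilon>"
    proof (rule mult_left_mono[OF few measure_nonneg])
      show "finite A" "finite B" using ab finAB unfolding AB by blast+
      show "A \<inter> B = {}" "n \<le> card A" "n \<le> card B" using ab unfolding AB P_def by simp_all
    qed
    finally show "prob (E' ab) \<le> prob (E ab) * \<epsilon>" .
  qed
  also have "\<dots> = prob (\<Union>ab\<in>P. E ab) * \<epsilon>"
  proof -
    have "disjoint_family_on E P"
      by (auto simp: disjoint_family_on_def E_def)
    then have "prob (\<Union>ab\<in>P. E ab) = (\<Sum>ab\<in>P. prob (E ab))"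
      by (intro finite_measure_finite_Union finP image_subsetI E)
    then show ?thesis by (simp add: sum_distrib_right)
  qed
  also have "\<dots> \<le> 1 * \<epsilon>"
    using \<epsilon> by (intro mult_right_mono) auto
  finally have EP: "prob (\<Union>ab\<in>P. E' ab) \<le> \<epsilon>" by simp
  have EU: "(\<Union>ab\<in>P. E' ab) \<in> events"
    by (intro sets.finite_UN finP E')
  have "prob {\<omega>\<in>space coupling. \<not> open_conn adj (layers {0, 1, 2} \<omega>) x y \<and>
      n \<le> card (explored_top \<Lambda> x \<omega>) \<and> n \<le> card (explored_bot \<Lambda> y \<omega>)} \<le> prob ((\<Union>ab\<in>P. E' ab) \<union> C)"
    by (intro finite_measure_mono sub sets.Un EU C)
  also have "\<dots> \<le> prob (\<Union>ab\<in>P. E' ab) + prob C"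
    by (intro measure_Un_le EU C)
  finally show ?thesis using EP C by linarith
qed

subsection \<open>Uniqueness of the infinite cluster\<close>

text \<open>The limit hypothesis of the theorem, moved to layer 0 and freed of the supremum.\<close>

definition large_sets_connected :: bool where
  "large_sets_connected \<longleftrightarrow> (\<forall>\<epsilon>>0. \<exists>n. \<forall>A B. finite A \<longrightarrow> finite B \<longrightarrow> n \<le> card A \<longrightarrow> n \<le> card B \<longrightarrow>
     prob {\<omega>\<in>space coupling. layers {0} \<omega> \<notin> connects adj A B} \<le> \<epsilon>)"

text \<open>Combines the estimates at \<open>B\<close> and at \<open>A\<close>. The constants are
  chosen in the order \<open>k\<close>, \<open>j\<close>, \<open>n\<close>: the price
  \<open>c\<close> of closing the exits at \<open>A\<close> depends on \<open>k\<close>, and both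
  error terms at \<open>B\<close> must be small compared with \<open>c\<close>.\<close>

lemma few_fresh_exits_unlikely:
  assumes lsc: large_sets_connected and \<epsilon>: "0 < \<epsilon>"
  shows "\<exists>n. \<forall>A B. finite A \<longrightarrow> finite B \<longrightarrow> A \<inter> B = {} \<longrightarrow> n \<le> card A \<longrightarrow> n \<le> card B \<longrightarrow>
     prob {\<omega>\<in>space coupling. card (exits adj (fresh B \<omega>) A B) < k} \<le> \<epsilon>"
proof -
  define c where "c = min (1 - p0) (1 - s1) ^ k"
  have c: "0 < c" using p0 s1 by (simp add: c_def)
  \<comment> \<open>\<open>j\<close> is the threshold for boundary edges of \<open>B\<close>: with
    at least \<open>j\<close> of them, layer 1 fails with probability below
    \<open>c * \<epsilon> / 2\<close>.\<close>
  obtain j where j: "(1 - s1) ^ j < c * \<epsilon> / 2"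
    using real_arch_pow_inv[of "c * \<epsilon> / 2" "1 - s1"] c \<epsilon> s1 by auto
  have d: "0 < (1 - p0) ^ j" using p0 by simp
  \<comment> \<open>The factor \<open>(1 - p0) ^ j\<close> compensates for the division in
    \<open>fresh_disconnected_le\<close>; the other half of \<open>c * \<epsilon>\<close> remains
    for layer 1.\<close>
  have "0 < (1 - p0) ^ j * (c * \<epsilon> / 2)" using c d \<epsilon> by simp
  then obtain n where n: "\<And>A B. finite A \<Longrightarrow> finite B \<Longrightarrow> n \<le> card A \<Longrightarrow> n \<le> card B \<Longrightarrow>
     prob {\<omega>\<in>space coupling. layers {0} \<omega> \<notin> connects adj A B} \<le> (1 - p0) ^ j * (c * \<epsilon> / 2)"
    using lsc unfolding large_sets_connected_def by blast
  show ?thesis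
  proof (intro exI[of _ n] allI impI)
    fix A B :: "'v set"
    assume A: "finite A" and B: "finite B" and AB: "A \<inter> B = {}" and nA: "n \<le> card A" and nB: "n \<le> card B"
    have "prob {\<omega>\<in>space coupling. layers {0} \<omega> \<notin> connects adj A B} / (1 - p0) ^ j \<le> c * \<epsilon> / 2"
      using n[OF A B nA nB] d by (simp add: pos_divide_le_eq mult.commute)
    then have "prob {\<omega>\<in>space coupling. fresh B \<omega> \<notin> connects adj A B} \<le> c * \<epsilon>"
      using fresh_disconnected_le[OF A B AB, of j] j by linarith
    then have "c * prob {\<omega>\<in>space coupling. card (exits adj (fresh B \<omega>) A B) < k} \<le> c * \<epsilon>"
      using few_fresh_exits_le[OF A AB, of k] unfolding c_def by linarith
    then show "prob {\<omega>\<in>space coupling. card (exits adj (fresh B \<omega>) A B) < k} \<le> \<epsilon>"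
      using c by simp
  qed
qed

text \<open>Once the windows are large enough, both explored clusters have at least \<open>n\<close>
  vertices. Since the bound on disconnection is uniform in the window, it survives the increasing
  limit.\<close>

lemma AE_infinite_clusters_meet:
  assumes lsc: large_sets_connected
  shows "AE \<omega> in coupling. infinite (cluster adj (layers {0, 1, 2} \<omega>) x) \<longrightarrow>
     infinite (cluster adj (layers {0} \<omega>) y) \<longrightarrow> open_conn adj (layers {0, 1, 2} \<omega>) x y"
proof -
  define N where "N = {\<omega>\<in>space coupling. infinite (cluster adj (layers {0, 1, 2} \<omega>) x) \<and>
     infinite (cluster adj (layers {0} \<omega>) y) \<and> \<not> open_conn adj (layers {0, 1, 2} \<omega>) x y}"
  have lay: "Measurable.pred coupling (\<lambda>\<omega>. layers {0, 1, 2} \<omega> e)" "Measurable.pred coupling (\<lambda>\<omega>. layers {0} \<omega> e)"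
    if "e \<in> graph_edges adj" for e
    using that by (auto intro: pred_layers)
  have mN: "Measurable.pred coupling (\<lambda>\<omega>. infinite (cluster adj (layers {0, 1, 2} \<omega>) x) \<and>
     infinite (cluster adj (layers {0} \<omega>) y) \<and> \<not> open_conn adj (layers {0, 1, 2} \<omega>) x y)"
    by (intro pred_intros_logic(3) pred_infinite_cluster pred_intros_logic(2)[OF pred_open_conn] lay)
  have N: "N \<in> events" unfolding N_def by (rule predE[OF mN])
  have "prob N \<le> \<epsilon>" if \<epsilon>: "0 < \<epsilon>" for \<epsilon>
  proof -
    \<comment> \<open>\<open>k\<close> makes it unlikely that layer 2 is closed on \<open>k\<close>
      contacts. Only then is \<open>n\<close> chosen, since it depends on \<open>k\<close>.\<close>
    obtain k where k: "(1 - s2) ^ k < \<epsilon> / 2"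
      using real_arch_pow_inv[of "\<epsilon> / 2" "1 - s2"] \<epsilon> s2 by auto
    obtain n where n: "\<And>A B. finite A \<Longrightarrow> finite B \<Longrightarrow> A \<inter> B = {} \<Longrightarrow> n \<le> card A \<Longrightarrow> n \<le> card B \<Longrightarrow>
      prob {\<omega>\<in>space coupling. card (exits adj (fresh B \<omega>) A B) < k} \<le> \<epsilon> / 2"
      using few_fresh_exits_unlikely[OF lsc, of "\<epsilon> / 2" k] \<epsilon> by auto
    define Q where "Q m \<omega> \<longleftrightarrow> \<not> open_conn adj (layers {0, 1, 2} \<omega>) x y \<and>
      n \<le> card (explored_top (initial m) x \<omega>) \<and> n \<le> card (explored_bot (initial m) y \<omega>)" for m \<omega>
    define G where "G m = N \<inter> {\<omega>\<in>space coupling. Q m \<omega>}" for m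
    have "Measurable.pred coupling (Q m)" for m
      unfolding Q_def by (intro pred_intros_logic(2,3) pred_card_explored pred_open_conn lay finite_initial)
    from predE[OF this] have Q: "{\<omega>\<in>space coupling. Q m \<omega>} \<in> events" for m .
    have Gm: "G m \<in> events" for m
      unfolding G_def by (intro sets.Int N Q)
    have "prob (G m) \<le> \<epsilon>" for m
    proof -
      have "prob (G m) \<le> prob {\<omega>\<in>space coupling. Q m \<omega>}"
        by (intro finite_measure_mono Q) (simp add: G_def)
      also have "\<dots> \<le> \<epsilon> / 2 + (1 - s2) ^ k"
        unfolding Q_def by (rule explored_disconnected_le) (use \<epsilon> n in auto)
      finally show ?thesis using k by simp
    qed
    moreover have "incseq G"
    proof (rule incseq_SucI)
      fix m
      have "Q (Suc m) \<omega>" if "Q m \<omega>" for \<omega>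
        using that card_mono[OF finite_explored explored_cluster_mono[of m "Suc m" "layers {0, 1, 2} \<omega>" x]]
          card_mono[OF finite_explored explored_cluster_mono[of m "Suc m" "layers {0} \<omega>" y]]
        unfolding Q_def by linarith
      then show "G m \<subseteq> G (Suc m)" by (auto simp: G_def)
    qed
    ultimately have "prob (\<Union>m. G m) \<le> \<epsilon>"
      by (intro measure_incseq_Union_le Gm)
    moreover have "N \<subseteq> (\<Union>m. G m)"
    proof
      fix \<omega> assume \<omega>: "\<omega> \<in> N"
      then obtain m m' where m: "n \<le> card (explored_top (initial m) x \<omega>)" and m': "n \<le> card (explored_bot (initial m') y \<omega>)"
        using explored_card_unbounded[of "layers {0, 1, 2} \<omega>" x n] explored_card_unbounded[of "layers {0} \<omega>" y n]
        unfolding N_def by blast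
      have "Q (max m m') \<omega>"
        using m m' \<omega>
          card_mono[OF finite_explored explored_cluster_mono[of m "max m m'" "layers {0, 1, 2} \<omega>" x]]
          card_mono[OF finite_explored explored_cluster_mono[of m' "max m m'" "layers {0} \<omega>" y]]
        unfolding Q_def N_def by simp
      with \<omega> show "\<omega> \<in> (\<Union>m. G m)" by (auto simp: G_def N_def)
    qed
    moreover have "(\<Union>m. G m) \<in> events"
      using Gm by (intro sets.countable_UN) blast
    ultimately show ?thesis
      using finite_measure_mono[of N "\<Union>m. G m"] by linarith
  qed
  then have "prob N \<le> 0" by (rule field_le_epsilon[of _ 0, simplified])
  then have "N \<in> null_sets coupling"
    using N by (intro null_setsI) (simp_all only: emeasure_eq_measure measure_le_0_iff ennreal_0)
  then show ?thesis
    by (rule AE_I') (auto simp: N_def)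
qed

text \<open>If all clusters of a set \<open>A\<close> of \<open>n\<close> vertices are finite, some
  window contains them, and \<open>A\<close> is then disconnected from any \<open>n\<close> vertices
  outside that window. The bound is uniform in the window.\<close>

lemma AE_exists_infinite_cluster:
  assumes lsc: large_sets_connected
  shows "AE \<omega> in coupling. \<exists>y. infinite (cluster adj (layers {0} \<omega>) y)"
proof -
  define N where "N = {\<omega>\<in>space coupling. \<not> (\<exists>y. infinite (cluster adj (layers {0} \<omega>) y))}"
  have lay: "Measurable.pred coupling (\<lambda>\<omega>. layers {0} \<omega> e)" if "e \<in> graph_edges adj" for e
    using that by (auto intro: pred_layers)
  have "Measurable.pred coupling (\<lambda>\<omega>. \<not> (\<exists>y. infinite (cluster adj (layers {0} \<omega>) y)))"
    by (rule pred_intros_logic(2)[OF pred_ex_countable[OF countable_vertices pred_infinite_cluster[OF lay]]])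
  from predE[OF this] have N: "N \<in> events" unfolding N_def .
  have "prob N \<le> \<epsilon>" if \<epsilon>: "0 < \<epsilon>" for \<epsilon>
  proof -
    obtain n where n: "\<And>A B. finite A \<Longrightarrow> finite B \<Longrightarrow> n \<le> card A \<Longrightarrow> n \<le> card B \<Longrightarrow>
      prob {\<omega>\<in>space coupling. layers {0} \<omega> \<notin> connects adj A B} \<le> \<epsilon>"
      using lsc \<epsilon> unfolding large_sets_connected_def by blast
    obtain A :: "'v set" where A: "finite A" "card A = n"
      using infinite_arbitrarily_large[OF infinite_vertices] by blast
    define H where "H m = {\<omega>\<in>space coupling. \<forall>a\<in>A. \<forall>v. open_conn adj (layers {0} \<omega>) a v \<longrightarrow> v \<in> initial m}" for m
    have "Measurable.pred coupling (\<lambda>\<omega>. \<forall>a\<in>A. \<forall>v. open_conn adj (layers {0} \<omega>) a v \<longrightarrow> v \<in> initial m)" for m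
      by (intro pred_intros_finite(3) A pred_all_countable[OF countable_vertices] pred_intros_logic(4)
        pred_constant pred_open_conn lay)
    from predE[OF this] have H: "H m \<in> events" for m unfolding H_def .
    have "prob (H m) \<le> \<epsilon>" for m
    proof -
      have "infinite (- initial m)"
        unfolding Compl_eq_Diff_UNIV by (intro Diff_infinite_finite infinite_vertices finite_initial)
      then obtain B where B: "finite B" "card B = n" "B \<subseteq> - initial m"
        using infinite_arbitrarily_large by blast
      have "Measurable.pred coupling (\<lambda>\<omega>. layers {0} \<omega> \<notin> connects adj A B)"
        by (intro pred_intros_logic(2) pred_connects lay)
      note mB = predE[OF this]
      have "H m \<subseteq> {\<omega>\<in>space coupling. layers {0} \<omega> \<notin> connects adj A B}"
        using B(3) unfolding H_def connects_def by blast
      then have "prob (H m) \<le> prob {\<omega>\<in>space coupling. layers {0} \<omega> \<notin> connects adj A B}"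
        using mB by (rule finite_measure_mono)
      also have "\<dots> \<le> \<epsilon>" using A B by (intro n) simp_all
      finally show ?thesis .
    qed
    moreover have "incseq H"
    proof (rule incseq_SucI)
      show "H m \<subseteq> H (Suc m)" for m
        using initial_mono[of m "Suc m"] unfolding H_def by (simp only: le_SucI order_refl) blast
    qed
    ultimately have "prob (\<Union>m. H m) \<le> \<epsilon>"
      using H by (intro measure_incseq_Union_le)
    moreover have "N \<subseteq> (\<Union>m. H m)"
    proof
      fix \<omega> assume \<omega>: "\<omega> \<in> N"
      then have "finite (\<Union>a\<in>A. cluster adj (layers {0} \<omega>) a)"
        using A unfolding N_def by blast
      then obtain m where "(\<Union>a\<in>A. cluster adj (layers {0} \<omega>) a) \<subseteq> initial m"
        using finite_subset_initial by blast
      then have "\<omega> \<in> H m" using \<omega> by (auto simp: H_def N_def cluster_def)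
      then show "\<omega> \<in> (\<Union>m. H m)" by blast
    qed
    moreover have "(\<Union>m. H m) \<in> events"
      using H by (intro sets.countable_UN) blast
    ultimately show ?thesis
      using finite_measure_mono[of N "\<Union>m. H m"] by linarith
  qed
  then have "prob N \<le> 0" by (rule field_le_epsilon[of _ 0, simplified])
  then have "N \<in> null_sets coupling"
    using N by (intro null_setsI) (simp_all only: emeasure_eq_measure measure_le_0_iff ennreal_0)
  then show ?thesis
    by (rule AE_I') (auto simp: N_def)
qed

text \<open>An infinite layer-0 cluster serves as a common reference: almost surely every infinite
  cluster of all three layers meets the three-layer cluster containing it. Only countably many pairs
  of vertices are involved.\<close>

lemma AE_unique_infinite_cluster:
  assumes lsc: large_sets_connected
  shows "AE \<omega> in coupling. unique_infinite_cluster adj (layers {0, 1, 2} \<omega>)"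
proof -
  have "AE \<omega> in coupling. \<forall>x\<in>UNIV. \<forall>y\<in>UNIV. infinite (cluster adj (layers {0, 1, 2} \<omega>) x) \<longrightarrow>
     infinite (cluster adj (layers {0} \<omega>) y) \<longrightarrow> open_conn adj (layers {0, 1, 2} \<omega>) x y"
    by (intro AE_ball_countable[OF countable_vertices, THEN iffD2] ballI AE_infinite_clusters_meet[OF lsc])
  with AE_exists_infinite_cluster[OF lsc] show ?thesis
  proof eventually_elim
    case (elim \<omega>)
    then obtain y where y: "infinite (cluster adj (layers {0} \<omega>) y)" by blast
    have "cluster adj (layers {0} \<omega>) y \<subseteq> cluster adj (layers {0, 1, 2} \<omega>) y"
      by (rule cluster_mono) (auto intro: layers_mono[of "{0}"])
    then have "infinite (cluster adj (layers {0, 1, 2} \<omega>) y)"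
      using y finite_subset by blast
    moreover have "open_conn adj (layers {0, 1, 2} \<omega>) y z" if "infinite (cluster adj (layers {0, 1, 2} \<omega>) z)" for z
      by (rule open_conn_sym) (use elim(2) y that in blast)
    ultimately show ?case
      unfolding unique_infinite_cluster_iff by blast
  qed
qed

lemma AE_perc_unique_infinite_cluster:
  assumes lsc: large_sets_connected and p: "0 \<le> p" "p \<le> 1" "(1 - p0) * (1 - s1) * (1 - s2) = 1 - p"
  shows "AE \<omega> in perc adj p. unique_infinite_cluster adj \<omega>"
proof -
  let ?f = "\<lambda>\<omega>. \<lambda>e\<in>graph_edges adj. layers {0, 1, 2} \<omega> e"
  have eq: "distr coupling (perc adj p) ?f = perc adj p"
    using p by (intro distr_layers) (auto simp: rate_def)
  have meas: "?f \<in> coupling \<rightarrow>\<^sub>M perc adj p"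
    unfolding perc_eq_bern by (intro measurable_bernI pred_layers) auto
  have "Measurable.pred (perc adj p) (\<lambda>f. unique_infinite_cluster adj f)"
    unfolding perc_eq_bern by (intro pred_unique_infinite_cluster bern_coord_measurable)
  then have S: "{f\<in>space (perc adj p). unique_infinite_cluster adj f} \<in> sets (perc adj p)"
    by (rule predE)
  have "unique_infinite_cluster adj (?f \<omega>) = unique_infinite_cluster adj (layers {0, 1, 2} \<omega>)" for \<omega>
  proof -
    have "open_conn adj (?f \<omega>) = open_conn adj (layers {0, 1, 2} \<omega>)"
      by (intro open_conn_cong) simp
    then show ?thesis by (simp only: unique_infinite_cluster_def cluster_def)
  qed
  then have "AE \<omega> in coupling. unique_infinite_cluster adj (?f \<omega>)"
    using AE_unique_infinite_cluster[OF lsc] by simp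
  then have "AE \<omega> in distr coupling (perc adj p) ?f. unique_infinite_cluster adj \<omega>"
    by (subst AE_distr_iff[OF meas S])
  then show ?thesis by (simp only: eq)
qed

end

section \<open>From the graph hypotheses to the coupling\<close>

text \<open>Walks of a fixed length from one vertex have finitely many endpoints, and by
  connectedness these finite sets cover the graph.\<close>

lemma connected_locally_finite_countable:
  fixes adj :: "'v \<Rightarrow> 'v \<Rightarrow> bool"
  assumes "graph_connected adj" "\<And>v. finite {u. adj v u}"
  shows "countable (UNIV :: 'v set)"
proof -
  fix v0 :: 'v
  have "finite {v. (adj ^^ n) v0 v}" for n
  proof (induction n)
    case (Suc n)
    have "{v. (adj ^^ Suc n) v0 v} = (\<Union>u\<in>{u. (adj ^^ n) v0 u}. {v. adj u v})"
      by auto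
    then show ?case using Suc assms(2) by (simp only:) (rule finite_UN_I)
  qed simp
  moreover have "UNIV = (\<Union>n. {v. (adj ^^ n) v0 v})"
    using assms(1) by (auto simp: graph_connected_def rtranclp_power)
  ultimately show ?thesis
    by (metis countable_UN countable_finite countableI_type)
qed

theorem theorem1p9:
  fixes adj :: "'v \<Rightarrow> 'v \<Rightarrow> bool" and p0 :: real
  assumes "simple_graph adj"
    and "infinite (UNIV :: 'v set)"
    and "graph_connected adj"
    and "bounded_degree adj"
    and "0 < p0" and "p0 < 1"
    and "max_disconn adj p0 \<longlonglongrightarrow> 0"
  shows "\<forall>p. p0 < p \<and> p \<le> 1 \<longrightarrow> (AE \<omega> in perc adj p. unique_infinite_cluster adj \<omega>)"
proof (intro allI impI)
  fix p :: real assume p: "p0 < p \<and> p \<le> 1"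
  \<comment> \<open>The sprinkling from \<open>p0\<close> to \<open>p\<close> is split at the
    midpoint, which is below 1 even for \<open>p = 1\<close>. The rates solve
    \<open>(1 - p0) * (1 - s1) = 1 - p1\<close> and
    \<open>(1 - p1) * (1 - s2) = 1 - p\<close>.\<close>
  define p1 where "p1 = (p0 + p) / 2"
  define s1 where "s1 = (p1 - p0) / (1 - p0)"
  define s2 where "s2 = (p - p1) / (1 - p1)"
  have p1: "p0 < p1" "p1 < p" "p1 < 1" using p by (auto simp: p1_def)
  have fin: "finite {u. adj v u}" for v
    using assms(4) by (auto simp: bounded_degree_def)
  have cnt: "countable (UNIV :: 'v set)"
    using assms(3) fin by (rule connected_locally_finite_countable)
  have edges: "graph_edges adj \<noteq> {}"
  proof -
    obtain u v :: 'v where "u \<noteq> v"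
      using assms(2) by (metis (full_types) UNIV_I ex_new_if_finite finite.emptyI finite_insert insertI1)
    moreover have "adj\<^sup>*\<^sup>* u v" using assms(3) by (simp add: graph_connected_def)
    ultimately obtain w where "adj u w" by (metis converse_rtranclpE)
    then show ?thesis by (auto simp: graph_edges_def)
  qed
  interpret perc_coupling adj p0 s1 s2
    by unfold_locales
      (use assms(1,2,5,6) p p1 fin cnt edges in \<open>auto simp: simple_graph_def s1_def s2_def divide_simps\<close>)
  have lsc: large_sets_connected
    unfolding large_sets_connected_def
  proof (intro allI impI)
    fix \<epsilon> :: real assume "0 < \<epsilon>"
    then obtain n where n: "\<bar>max_disconn adj p0 n\<bar> < \<epsilon>"
      using LIMSEQ_D[OF assms(7), of \<epsilon>] by auto
    show "\<exists>n. \<forall>A B. finite A \<longrightarrow> finite B \<longrightarrow> n \<le> card A \<longrightarrow> n \<le> card B \<longrightarrow>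
       prob {\<omega>\<in>space coupling. layers {0} \<omega> \<notin> connects adj A B} \<le> \<epsilon>"
    proof (intro exI[of _ n] allI impI)
      fix A B :: "'v set"
      assume AB: "finite A" "finite B" "n \<le> card A" "n \<le> card B"
      let ?g = "\<lambda>AB. measure (perc adj p0) (space (perc adj p0) - connects adj (fst AB) (snd AB))"
      let ?S = "{(A, B). finite A \<and> finite B \<and> card A \<ge> n \<and> card B \<ge> n}"
      interpret P: prob_space "perc adj p0"
        unfolding perc_eq_bern by (rule prob_space_bern)
      \<comment> \<open>On the reals a supremum dominates its members only for a family bounded
        above; here probabilities are bounded by 1.\<close>
      have "bdd_above (?g ` ?S)"
        by (rule bdd_aboveI2[where M=1]) simp
      moreover have "(A, B) \<in> ?S" using AB by simp
      ultimately have "?g (A, B) \<le> max_disconn adj p0 n"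
        unfolding max_disconn_def by (rule cSUP_upper[rotated])
      then show "prob {\<omega>\<in>space coupling. layers {0} \<omega> \<notin> connects adj A B} \<le> \<epsilon>"
        using n by (simp add: prob_disconnected_perc)
    qed
  qed
  have "(1 - p0) * (1 - s1) * (1 - s2) = 1 - p"
  proof -
    have "(1 - p0) * (1 - s1) = 1 - p1" "(1 - p1) * (1 - s2) = 1 - p"
      using p1 assms(6) by (simp_all add: s1_def s2_def field_simps)
    then show ?thesis by simp
  qed
  then show "AE \<omega> in perc adj p. unique_infinite_cluster adj \<omega>"
    using lsc p assms(5) by (intro AE_perc_unique_infinite_cluster) auto
qed

end
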